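(* Let $m,\sigma>0$, $a\equiv1$ on $[0,1]$, $\tau=\sqrt2$, $M=\sqrt2/\sigma$ and $\alpha=\sqrt2\left(1+\frac mM\right)e^{2/M}$, and let $K>0$ satisfy $\alpha\le K$. Then the semigroup $e^{t\tilde{\mathcal{A}}_0}$ on $\tilde{\mathcal{H}}_0$ (defined in the context) is not stable: there is an initial condition $\Phi_0\in\tilde{\mathcal{H}}_0$ for which $e^{t\tilde{\mathcal{A}}_0}\Phi_0$ does not tend to $0$ in $\tilde{\mathcal{H}}_0$ as $t\to+\infty$. In other words, the solutions in $\mathcal{H}_0$ of the closed-loop system $$\begin{cases} y_{tt}(x,t)-y_{xx}(x,t)+\sigma y_t(x,t)=0, & 0<x<1,\ t>0,\\ m y_{tt}(0,t)-y_x(0,t)=\alpha y_t(0,t-\tau), & t>0,\\ M y_{tt}(1,t)+y_x(1,t)=0, & t>0,\end{cases}$$ do not converge to their equilibrium state as $t\to+\infty$: it is not the case that for every initial condition $\Phi_0\in\mathcal{H}_0$ the solution $e^{t\mathcal{A}_0}\Phi_0$ converges in $\mathcal{H}_0$ to some equilibrium state $(C,0,0,0,0)$, $C\in\mathbb{R}$.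
   Context: State space: $\mathcal{H}_0=H^1(0,1)\times L^2(0,1)\times L^2(0,1)\times\mathbb{R}^2$ (real-valued functions), equipped with the inner product $$\langle(y,z,u,\xi,\eta),(\tilde y,\tilde z,\tilde u,\tilde\xi,\tilde\eta)\rangle_{\mathcal{H}_0}=\int_0^1(a y_x\tilde y_x+z\tilde z)\,dx+K\tau\int_0^1u\tilde u\,dx+m\xi\tilde\xi+M\eta\tilde\eta+\varpi\,J_0(y,z,u,\xi,\eta)\,J_0(\tilde y,\tilde z,\tilde u,\tilde\xi,\tilde\eta),$$ where $$J_0(y,z,u,\xi,\eta)=\int_0^1(\sigma y+z)\,dx+m\xi+M\eta-\alpha y(0)+\tau\alpha\int_0^1u\,dx,$$ and $\varpi>0$ is a constant taken sufficiently small so that the induced norm is equivalent to the usual product norm of $\mathcal{H}_0$; thus convergence in $\mathcal{H}_0$ is convergence in the usual product norm. Operator: $$\mathcal{D}(\mathcal{A}_0)=\{(y,z,u,\xi,\eta)\in\mathcal{H}_0:\ y\in H^2(0,1),\ z,u\in H^1(0,1),\ \xi=u(0)=z(0),\ \eta=z(1)\},$$ $$\mathcal{A}_0(y,z,u,\xi,\eta)=\Big(z,\ (ay_x)_x-\sigma z,\ -\frac{u_x}{\tau},\ \frac1m\big[(ay_x)(0)+\alpha u(1)\big],\ -\frac{(ay_x)(1)}{M}\Big).$$ $\mathcal{A}_0$ generates a $C_0$-semigroup $e^{t\mathcal{A}_0}$ on $\mathcal{H}_0$. The closed-loop system is identified with $\Phi_t=\mathcal{A}_0\Phi$ through $\Phi(t)=(y(\cdot,t),y_t(\cdot,t),u(\cdot,t),y_t(0,t),y_t(1,t))$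 with $u(x,t)=y_t(0,t-x\tau)$. Restricted operator: $\tilde{\mathcal{H}}_0=\{\Phi\in\mathcal{H}_0:\ J_0(\Phi)=0\}$, $\mathcal{D}(\tilde{\mathcal{A}}_0)=\mathcal{D}(\mathcal{A}_0)\cap\tilde{\mathcal{H}}_0$ and $\tilde{\mathcal{A}}_0\Phi=\mathcal{A}_0\Phi$ for $\Phi\in\mathcal{D}(\tilde{\mathcal{A}}_0)$; it generates a $C_0$-semigroup $e^{t\tilde{\mathcal{A}}_0}$ on $\tilde{\mathcal{H}}_0$. *)

theory Defs
  imports "HOL-Analysis.Analysis"
begin

section \<open>The real Hilbert space $L^2(0,1)$\<close>

abbreviation unit_lebesgue :: "real measure" where
  "unit_lebesgue \<equiv> lebesgue_on {0<..<1}"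

definition square_integrable :: "(real \<Rightarrow> real) \<Rightarrow> bool" where
  "square_integrable f \<longleftrightarrow>
     f \<in> borel_measurable unit_lebesgue \<and> integrable unit_lebesgue (\<lambda>x. (f x)\<^sup>2)"

lemma square_integrable_zero: "square_integrable (\<lambda>_. 0)"
  by (simp add: square_integrable_def)

lemma square_integrable_mult:
  assumes "square_integrable f" "square_integrable g"
  shows "integrable unit_lebesgue (\<lambda>x. f x * g x)"
proof (rule Bochner_Integration.integrable_bound)
  show "integrable unit_lebesgue (\<lambda>x. (f x)\<^sup>2 + (g x)\<^sup>2)"
    using assms by (auto simp: square_integrable_def)
  show "(\<lambda>x. f x * g x) \<in> borel_measurable unit_lebesgue"
    using assms by (auto simp: square_integrable_def intro: borel_measurable_times)
  have "\<bar>f x * g x\<bar> \<le> (f x)\<^sup>2 + (g x)\<^sup>2" for x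
  proof -
    have "2 * (\<bar>f x\<bar> * \<bar>g x\<bar>) \<le> (f x)\<^sup>2 + (g x)\<^sup>2"
      using sum_squares_bound[of "\<bar>f x\<bar>" "\<bar>g x\<bar>"] by (simp add: mult.assoc)
    moreover have "0 \<le> \<bar>f x\<bar> * \<bar>g x\<bar>" by simp
    ultimately show ?thesis by (simp only: abs_mult)
  qed
  then show "AE x in unit_lebesgue. norm (f x * g x) \<le> norm ((f x)\<^sup>2 + (g x)\<^sup>2)"
    by simp
qed

lemma square_integrable_add:
  assumes "square_integrable f" "square_integrable g"
  shows "square_integrable (\<lambda>x. f x + g x)"
proof -
  have "integrable unit_lebesgue (\<lambda>x. (f x)\<^sup>2 + 2 * (f x * g x) + (g x)\<^sup>2)"
    using assms square_integrable_mult[OF assms]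
    by (intro Bochner_Integration.integrable_add integrable_mult_right)
       (auto simp: square_integrable_def)
  moreover have "(\<lambda>x. (f x + g x)\<^sup>2) = (\<lambda>x. (f x)\<^sup>2 + 2 * (f x * g x) + (g x)\<^sup>2)"
    by (auto simp: power2_eq_square algebra_simps)
  ultimately show ?thesis
    using assms by (auto simp: square_integrable_def intro: borel_measurable_add)
qed

lemma square_integrable_scale:
  assumes "square_integrable f"
  shows "square_integrable (\<lambda>x. c * f x)"
  using assms by (auto simp: square_integrable_def power_mult_distrib)

definition l2_rel :: "(real \<Rightarrow> real) \<Rightarrow> (real \<Rightarrow> real) \<Rightarrow> bool" where
  "l2_rel f g \<longleftrightarrow> square_integrable f \<and> square_integrable g \<and> (AE x in unit_lebesgue. f x = g x)"

quotient_type l2 = "real \<Rightarrow> real" / partial: l2_rel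
proof (rule part_equivpI)
  show "\<exists>f. l2_rel f f"
    using square_integrable_zero by (auto simp: l2_rel_def)
  show "symp l2_rel"
    by (auto simp: symp_def l2_rel_def elim: eventually_mono)
  show "transp l2_rel"
    by (auto simp: transp_def l2_rel_def elim: eventually_elim2)
qed

instantiation l2 :: real_vector
begin

lift_definition zero_l2 :: l2 is "\<lambda>_. 0"
  by (simp add: l2_rel_def square_integrable_zero)

lift_definition plus_l2 :: "l2 \<Rightarrow> l2 \<Rightarrow> l2" is "\<lambda>f g x. f x + g x"
  by (auto simp: l2_rel_def square_integrable_add elim: eventually_elim2)

lift_definition uminus_l2 :: "l2 \<Rightarrow> l2" is "\<lambda>f x. - f x"
  using square_integrable_scale[of _ "-1"] by (auto simp: l2_rel_def elim: eventually_mono)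

lift_definition scaleR_l2 :: "real \<Rightarrow> l2 \<Rightarrow> l2" is "\<lambda>c f x. c * f x"
  by (auto simp: l2_rel_def intro!: square_integrable_scale elim: eventually_mono)

definition minus_l2 :: "l2 \<Rightarrow> l2 \<Rightarrow> l2" where "minus_l2 f g = f + - g"

instance
proof
  fix f g h :: l2 and c d :: real
  show "f + g + h = f + (g + h)"
    by transfer (auto simp: l2_rel_def add.assoc intro!: square_integrable_add)
  show "f + g = g + f"
    by transfer (auto simp: l2_rel_def add.commute intro!: square_integrable_add)
  show "0 + f = f"
    by transfer (auto simp: l2_rel_def)
  show "- f + f = 0"
    by transfer (auto simp: l2_rel_def square_integrable_zero)
  show "f - g = f + - g"
    by (rule minus_l2_def)
  show "c *\<^sub>R (f + g) = c *\<^sub>R f + c *\<^sub>R g"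
    by transfer (auto simp: l2_rel_def distrib_left
        intro!: square_integrable_add square_integrable_scale)
  show "(c + d) *\<^sub>R f = c *\<^sub>R f + d *\<^sub>R f"
    by transfer (auto simp: l2_rel_def distrib_right
        intro!: square_integrable_add square_integrable_scale)
  show "c *\<^sub>R d *\<^sub>R f = (c * d) *\<^sub>R f"
    by transfer (auto simp: l2_rel_def mult.assoc intro!: square_integrable_scale)
  show "1 *\<^sub>R f = f"
    by transfer (auto simp: l2_rel_def)
qed

end

instantiation l2 :: real_inner
begin

lift_definition inner_l2 :: "l2 \<Rightarrow> l2 \<Rightarrow> real" is "\<lambda>f g. LINT x|unit_lebesgue. f x * g x"
proof -
  fix f f' g g' assume "l2_rel f f'" "l2_rel g g'"
  then show "(LINT x|unit_lebesgue. f x * g x) = (LINT x|unit_lebesgue. f' x * g' x)"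
    by (intro integral_cong_AE)
       (auto simp: l2_rel_def square_integrable_def intro: borel_measurable_times
         elim: eventually_elim2)
qed

definition norm_l2 :: "l2 \<Rightarrow> real" where "norm_l2 f = sqrt (inner f f)"
definition sgn_l2 :: "l2 \<Rightarrow> l2" where "sgn_l2 f = f /\<^sub>R norm f"
definition dist_l2 :: "l2 \<Rightarrow> l2 \<Rightarrow> real" where "dist_l2 f g = norm (f - g)"
definition uniformity_l2 :: "(l2 \<times> l2) filter" where
  "uniformity_l2 = (INF e\<in>{0<..}. principal {(f, g). dist f g < e})"
definition open_l2 :: "l2 set \<Rightarrow> bool" where
  "open_l2 S \<longleftrightarrow> (\<forall>f\<in>S. \<forall>\<^sub>F (f', g) in uniformity. f' = f \<longrightarrow> g \<in> S)"

instance
proof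
  fix f g h :: l2 and c :: real
  show "sgn f = f /\<^sub>R norm f"
    by (rule sgn_l2_def)
  show "dist f g = norm (f - g)"
    by (rule dist_l2_def)
  show "uniformity = (INF e\<in>{0<..}. principal {(f::l2, g). dist f g < e})"
    by (rule uniformity_l2_def)
  show "open S \<longleftrightarrow> (\<forall>f\<in>S. \<forall>\<^sub>F (f', g) in uniformity. f' = f \<longrightarrow> g \<in> S)" for S :: "l2 set"
    by (rule open_l2_def)
  show "inner f g = inner g f"
    by transfer (simp add: mult.commute)
  show "inner (f + g) h = inner f h + inner g h"
    by transfer (auto simp: l2_rel_def distrib_right square_integrable_mult)
  show "inner (c *\<^sub>R f) g = c * inner f g"
    by transfer (auto simp: l2_rel_def mult.assoc)
  show "0 \<le> inner f f"
    by transfer (simp add: integral_nonneg_AE)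
  show "inner f f = 0 \<longleftrightarrow> f = 0"
  proof transfer
    fix f assume "l2_rel f f"
    then have f: "square_integrable f" by (simp add: l2_rel_def)
    then have "integrable unit_lebesgue (\<lambda>x. f x * f x)"
      by (rule square_integrable_mult) (rule f)
    then have "(LINT x|unit_lebesgue. f x * f x) = 0 \<longleftrightarrow> (AE x in unit_lebesgue. f x * f x = 0)"
      by (rule integral_nonneg_eq_0_iff_AE) simp
    then show "(LINT x|unit_lebesgue. f x * f x) = 0 \<longleftrightarrow> l2_rel f (\<lambda>_. 0)"
      using f square_integrable_zero by (simp add: l2_rel_def)
  qed
  show "norm f = sqrt (inner f f)"
    by (rule norm_l2_def)
qed

end

section \<open>Sobolev spaces on the interval\<close>

text \<open>
  Weak derivatives are tested against \<open>C\<^sup>1\<close> functions with compact support in \<open>(0,1)\<close>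
  (the definition of $W^{1,2}(0,1)$ in Brezis' textbook); \<open>\<phi>'\<close> is the classical derivative of \<open>\<phi>\<close>.
\<close>

definition test_function :: "(real \<Rightarrow> real) \<Rightarrow> (real \<Rightarrow> real) \<Rightarrow> bool" where
  "test_function \<phi> \<phi>' \<longleftrightarrow>
     (\<forall>x. (\<phi> has_real_derivative \<phi>' x) (at x)) \<and> continuous_on UNIV \<phi>' \<and>
     closure {x. \<phi> x \<noteq> 0} \<subseteq> {0<..<1}"

definition has_weak_deriv :: "l2 \<Rightarrow> l2 \<Rightarrow> bool" where
  "has_weak_deriv f g \<longleftrightarrow>
     (\<forall>\<phi> \<phi>'. test_function \<phi> \<phi>' \<longrightarrow>
        (LINT x|unit_lebesgue. rep_l2 f x * \<phi>' x) = - (LINT x|unit_lebesgue. rep_l2 g x * \<phi> x))"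

definition H1 :: "l2 set" where
  "H1 = {f. \<exists>g. has_weak_deriv f g}"

definition weak_deriv :: "l2 \<Rightarrow> l2" where
  "weak_deriv f = (THE g. has_weak_deriv f g)"

definition H2 :: "l2 set" where
  "H2 = {f \<in> H1. weak_deriv f \<in> H1}"

text \<open>
  The value at \<open>x \<in> [0,1]\<close> of the continuous representative, which is unique and exists
  for every element of \<open>H1\<close>.
\<close>

definition pt_value :: "l2 \<Rightarrow> real \<Rightarrow> real" where
  "pt_value f x =
     (THE c. \<exists>g. continuous_on {0..1} g \<and> (AE s in unit_lebesgue. rep_l2 f s = g s) \<and> g x = c)"

text \<open>
  The product of the coefficient \<open>a\<close> and \<open>f \<in> L\<^sup>2\<close>; meaningful only if \<open>a f\<close> is again
  square integrable, for instance if \<open>a\<close> is continuous on \<open>[0,1]\<close>.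
\<close>

definition coeff_mult :: "(real \<Rightarrow> real) \<Rightarrow> l2 \<Rightarrow> l2" where
  "coeff_mult a f = abs_l2 (\<lambda>x. a x * rep_l2 f x)"

section \<open>Strongly continuous semigroups\<close>

text \<open>
  The space is a linear subspace \<open>X\<close> of a real vector space with its own norm \<open>N\<close>, since the
  energy norms below depend on parameters. Only the values \<open>T t x\<close> with \<open>t \<ge> 0\<close> and \<open>x \<in> X\<close>
  matter.
\<close>

definition c0_semigroup ::
  "'a::real_vector set \<Rightarrow> ('a \<Rightarrow> real) \<Rightarrow> (real \<Rightarrow> 'a \<Rightarrow> 'a) \<Rightarrow> bool" where
  "c0_semigroup X N T \<longleftrightarrow>
     (\<forall>t\<ge>0. (\<forall>x\<in>X. T t x \<in> X) \<and>
            (\<forall>x\<in>X. \<forall>y\<in>X. T t (x + y) = T t x + T t y) \<and>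
            (\<forall>x\<in>X. \<forall>c. T t (c *\<^sub>R x) = c *\<^sub>R T t x) \<and>
            (\<exists>B. \<forall>x\<in>X. N (T t x) \<le> B * N x)) \<and>
     (\<forall>x\<in>X. T 0 x = x) \<and>
     (\<forall>s\<ge>0. \<forall>t\<ge>0. \<forall>x\<in>X. T (s + t) x = T s (T t x)) \<and>
     (\<forall>x\<in>X. \<forall>t\<ge>0. ((\<lambda>s. N (T s x - T t x)) \<longlongrightarrow> 0) (at t within {0..}))"

definition generator_graph ::
  "'a::real_vector set \<Rightarrow> ('a \<Rightarrow> real) \<Rightarrow> (real \<Rightarrow> 'a \<Rightarrow> 'a) \<Rightarrow> ('a \<times> 'a) set" where
  "generator_graph X N T =
     {(x, w). x \<in> X \<and> w \<in> X \<and>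
        ((\<lambda>t. N ((T t x - x) /\<^sub>R t - w)) \<longlongrightarrow> 0) (at_right 0)}"

definition generates_c0_semigroup ::
  "'a::real_vector set \<Rightarrow> ('a \<Rightarrow> real) \<Rightarrow> 'a set \<Rightarrow> ('a \<Rightarrow> 'a) \<Rightarrow> (real \<Rightarrow> 'a \<Rightarrow> 'a) \<Rightarrow> bool" where
  "generates_c0_semigroup X N D A T \<longleftrightarrow>
     c0_semigroup X N T \<and> generator_graph X N T = {(x, A x) |x. x \<in> D}"

section \<open>The energy space and the closed-loop operator\<close>

type_synonym state = "l2 \<times> l2 \<times> l2 \<times> real \<times> real"

definition H0_space :: "state set" where
  "H0_space = {(y, z, u, \<xi>, \<eta>). y \<in> H1}"

fun J0 :: "real \<Rightarrow> real \<Rightarrow> real \<Rightarrow> real \<Rightarrow> real \<Rightarrow> state \<Rightarrow> real" where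
  "J0 m M \<sigma> \<alpha> \<tau> (y, z, u, \<xi>, \<eta>) =
     (LINT x|unit_lebesgue. \<sigma> * rep_l2 y x + rep_l2 z x) + m * \<xi> + M * \<eta>
     - \<alpha> * pt_value y 0 + \<tau> * \<alpha> * (LINT x|unit_lebesgue. rep_l2 u x)"

fun H0_inner ::
  "(real \<Rightarrow> real) \<Rightarrow> real \<Rightarrow> real \<Rightarrow> real \<Rightarrow> real \<Rightarrow> real \<Rightarrow> real \<Rightarrow> real \<Rightarrow> state \<Rightarrow> state \<Rightarrow> real" where
  "H0_inner a m M \<sigma> \<alpha> \<tau> K \<omega> (y, z, u, \<xi>, \<eta>) (y', z', u', \<xi>', \<eta>') =
     (LINT x|unit_lebesgue. a x * rep_l2 (weak_deriv y) x * rep_l2 (weak_deriv y') x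
        + rep_l2 z x * rep_l2 z' x)
     + K * \<tau> * (LINT x|unit_lebesgue. rep_l2 u x * rep_l2 u' x) + m * \<xi> * \<xi>' + M * \<eta> * \<eta>'
     + \<omega> * J0 m M \<sigma> \<alpha> \<tau> (y, z, u, \<xi>, \<eta>) * J0 m M \<sigma> \<alpha> \<tau> (y', z', u', \<xi>', \<eta>')"

definition H0_norm ::
  "(real \<Rightarrow> real) \<Rightarrow> real \<Rightarrow> real \<Rightarrow> real \<Rightarrow> real \<Rightarrow> real \<Rightarrow> real \<Rightarrow> real \<Rightarrow> state \<Rightarrow> real" where
  "H0_norm a m M \<sigma> \<alpha> \<tau> K \<omega> \<Phi> = sqrt (H0_inner a m M \<sigma> \<alpha> \<tau> K \<omega> \<Phi> \<Phi>)"

fun H0_product_norm :: "state \<Rightarrow> real" where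
  "H0_product_norm (y, z, u, \<xi>, \<eta>) =
     sqrt ((norm y)\<^sup>2 + (norm (weak_deriv y))\<^sup>2 + (norm z)\<^sup>2 + (norm u)\<^sup>2 + \<xi>\<^sup>2 + \<eta>\<^sup>2)"

definition equivalent_norms_on :: "'a set \<Rightarrow> ('a \<Rightarrow> real) \<Rightarrow> ('a \<Rightarrow> real) \<Rightarrow> bool" where
  "equivalent_norms_on X N N' \<longleftrightarrow>
     (\<exists>c>0. \<exists>C>0. \<forall>x\<in>X. c * N' x \<le> N x \<and> N x \<le> C * N' x)"

definition A0_domain :: "state set" where
  "A0_domain = {(y, z, u, \<xi>, \<eta>). y \<in> H2 \<and> z \<in> H1 \<and> u \<in> H1 \<and>
     \<xi> = pt_value u 0 \<and> \<xi> = pt_value z 0 \<and> \<eta> = pt_value z 1}"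

fun A0 :: "(real \<Rightarrow> real) \<Rightarrow> real \<Rightarrow> real \<Rightarrow> real \<Rightarrow> real \<Rightarrow> real \<Rightarrow> state \<Rightarrow> state" where
  "A0 a m M \<sigma> \<alpha> \<tau> (y, z, u, \<xi>, \<eta>) =
     (let ay\<^sub>x = coeff_mult a (weak_deriv y)
      in (z,
          weak_deriv ay\<^sub>x - \<sigma> *\<^sub>R z,
          - (weak_deriv u /\<^sub>R \<tau>),
          (1 / m) * (pt_value ay\<^sub>x 0 + \<alpha> * pt_value u 1),
          - (pt_value ay\<^sub>x 1 / M)))"

definition H0_tilde :: "real \<Rightarrow> real \<Rightarrow> real \<Rightarrow> real \<Rightarrow> real \<Rightarrow> state set" where
  "H0_tilde m M \<sigma> \<alpha> \<tau> = {\<Phi> \<in> H0_space. J0 m M \<sigma> \<alpha> \<tau> \<Phi> = 0}"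

definition A0_tilde_domain :: "real \<Rightarrow> real \<Rightarrow> real \<Rightarrow> real \<Rightarrow> real \<Rightarrow> state set" where
  "A0_tilde_domain m M \<sigma> \<alpha> \<tau> = A0_domain \<inter> H0_tilde m M \<sigma> \<alpha> \<tau>"

definition equilibrium :: "real \<Rightarrow> state" where
  "equilibrium C = (abs_l2 (\<lambda>_. C), 0, 0, 0, 0)"

end

theory Submission
  imports Defs
begin

text \<open>
  For these parameters the closed loop has an exponentially growing solution in closed form,
  \<open>y(x,t) = exp (\<sigma> t - \<surd>2 \<sigma> x)\<close>. A wave \<open>exp (\<lambda> t - \<mu> x)\<close> solves the damped equation when
  \<open>\<mu>\<^sup>2 = \<lambda>\<^sup>2 + \<sigma> \<lambda>\<close>, which gives \<open>\<mu> = \<surd>2 \<sigma>\<close> for \<open>\<lambda> = \<sigma>\<close>. The condition at the right end asks for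
  \<open>M \<lambda>\<^sup>2 = \<mu>\<close>, that is \<open>M = \<surd>2 / \<sigma>\<close>. Since the delay is \<open>\<tau> = \<surd>2\<close>, the condition at the left end becomes
  \<open>\<alpha> exp (- \<surd>2 \<sigma>) = \<surd>2 + m \<sigma>\<close>, and this is the prescribed value of \<open>\<alpha>\<close>. The corresponding state
  \<open>\<Phi>\<close> (\<open>growing_mode\<close>) is thus an eigenvector of the operator with the positive eigenvalue \<open>\<sigma>\<close>, and
  its semigroup orbit \<open>exp (\<sigma> t) \<Phi>\<close> does not decay. It lies in the hyperplane \<open>J0 = 0\<close>,
  as must every eigenvector with nonzero eigenvalue, because \<open>J0\<close> is conserved by the flow. One
  and the same vector therefore refutes both claims: its velocity component grows, while it would
  have to tend to zero along any orbit that converges to an equilibrium.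

  Two facts turn this computation into a proof. The first is that an eigenvector of the generator
  has an exponential orbit (\<open>c0_semigroup_eigenvector\<close>). The orbit is only known to be
  differentiable from the right, so the argument rests on the elementary fact that a continuous
  function whose right derivative vanishes is constant.

  The second is that the objects of the problem, weak derivatives and point values of square
  integrable classes, behave as they should. Weak derivatives are unique by the fundamental lemma of
  the calculus of variations (\<open>AE_zero_if_orthogonal_to_test_functions\<close>), so
  those of the exponential profile are the classical ones. The semigroup argument on the hyperplane
  needs it to be a linear subspace, so the point value at \<open>0\<close>, which enters \<open>J0\<close>, must be
  additive on all of \<open>H1\<close>. This comes from the existence of a continuous
  representative (\<open>H1_continuous_representative\<close>): an element of \<open>H1\<close> differs by a constant from
  the primitive of its weak derivative, by Fubini's theorem and the lemma of du Bois-Reymond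
  (\<open>AE_constant_if_orthogonal_to_derivatives\<close>).
\<close>

section \<open>Eigenvectors of semigroup generators\<close>

text \<open>
  If \<open>g b \<noteq> g a\<close>, compare the distance of \<open>g t\<close> from \<open>g a\<close> with a line of small positive slope that
  ends below it at \<open>b\<close>. After the last time at which the distance is not above the line, it grows at
  least at the rate of the slope, which contradicts the vanishing right derivative at that time.
\<close>

lemma constant_if_right_derivative_zero:
  fixes g :: "real \<Rightarrow> 'a::real_normed_vector"
  assumes ab: "a \<le> b" and cont: "continuous_on {a..b} g"
    and deriv: "\<And>t. a \<le> t \<Longrightarrow> t < b \<Longrightarrow> (g has_vector_derivative 0) (at_right t)"
  shows "g b = g a"
proof (rule ccontr)
  assume "g b \<noteq> g a"
  then have pos: "norm (g b - g a) > 0" and "a < b"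
    using ab by (auto simp: order_le_less)
  \<comment> \<open>The line of slope \<open>e\<close> reaches half of the final distance at time \<open>b\<close>.\<close>
  define e where "e = norm (g b - g a) / (2 * (b - a))"
  have e: "e > 0" using pos \<open>a < b\<close> by (simp add: e_def)
  define \<psi> where "\<psi> t = norm (g t - g a) - e * (t - a)" for t
  define S where "S = {t \<in> {a..b}. \<psi> t \<le> 0}"
  have cont_psi: "continuous_on {a..b} \<psi>"
    unfolding \<psi>_def by (intro continuous_intros cont)
  have "closed S"
  proof -
    have "S = {a..b} \<inter> \<psi> -` {..0}" by (auto simp: S_def)
    then show ?thesis using continuous_closed_preimage[OF cont_psi, of "{..0}"] by simp
  qed
  moreover have "bounded S" unfolding S_def by (rule bounded_subset[of "{a..b}"]) auto
  ultimately have "compact S" by (simp add: compact_eq_bounded_closed)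
  moreover have "a \<in> S" using ab by (simp add: S_def \<psi>_def)
  ultimately obtain t where t: "t \<in> S" and tmax: "\<And>s. s \<in> S \<Longrightarrow> s \<le> t"
    using compact_attains_sup[of S] by auto
  have "\<psi> b = norm (g b - g a) / 2" using \<open>a < b\<close> by (simp add: \<psi>_def e_def field_simps)
  then have "\<psi> b > 0" using pos by linarith
  then have "b \<notin> S" by (simp add: S_def)
  with t have tb: "a \<le> t" "t < b" "\<psi> t \<le> 0" by (auto simp: S_def order_le_less)
  have "((\<lambda>s. (1 / norm (s - t)) *\<^sub>R (g s - g t)) \<longlongrightarrow> 0) (at_right t)"
    using deriv[OF tb(1,2)] by (simp add: has_vector_derivative_def has_derivative_within)
  from tendstoD[OF this e]
  have "\<forall>\<^sub>F s in at_right t. norm (g s - g t) / norm (s - t) < e"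
    by (simp add: dist_norm)
  moreover have "\<forall>\<^sub>F s in at_right t. s \<in> {t<..<b}"
    using tb eventually_at_right_real by blast
  ultimately have "\<forall>\<^sub>F s in at_right t. norm (g s - g t) / norm (s - t) < e \<and> s \<in> {t<..<b}"
    by eventually_elim simp
  then obtain s where s: "norm (g s - g t) / norm (s - t) < e" "t < s" "s < b"
    using eventually_happens'[OF trivial_limit_at_right_real] by fastforce
  have "norm (g s - g t) \<le> e * (s - t)"
    using s by (simp add: divide_less_eq)
  moreover have "norm (g s - g a) \<le> norm (g s - g t) + norm (g t - g a)"
    using norm_triangle_ineq[of "g s - g t" "g t - g a"] by simp
  ultimately have "\<psi> s \<le> 0"
    using tb(3) by (simp add: \<psi>_def algebra_simps)
  then have "s \<in> S" using s tb by (simp add: S_def)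
  with tmax[of s] s show False by simp
qed

text \<open>
  The orbit satisfies \<open>u' = c u\<close> in the sense of right derivatives, because \<open>T s\<close> is bounded and
  maps the difference quotient at \<open>0\<close> to that at \<open>s\<close>; hence \<open>exp (- c t) u(t)\<close> is constant. Limits are
  taken in the ambient norm, which \<open>N\<close> dominates on \<open>X\<close>.
\<close>

lemma c0_semigroup_eigenvector:
  fixes X :: "'a::real_normed_vector set"
  assumes C: "C \<ge> 0" and generates: "generates_c0_semigroup X N D A T" and X: "subspace X"
    and bound: "\<And>v. v \<in> X \<Longrightarrow> norm v \<le> C * N v"
    and eigen: "x \<in> D" "A x = c *\<^sub>R x" and t: "t \<ge> 0"
  shows "T t x = exp (c * t) *\<^sub>R x"
proof -
  have sg: "c0_semigroup X N T"
    using generates by (simp add: generates_c0_semigroup_def)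
  have "(x, A x) \<in> generator_graph X N T"
    using generates eigen(1) unfolding generates_c0_semigroup_def by blast
  then have ev: "(x, c *\<^sub>R x) \<in> generator_graph X N T"
    by (simp add: eigen(2))
  have x: "x \<in> X"
    and gen: "((\<lambda>h. N ((T h x - x) /\<^sub>R h - c *\<^sub>R x)) \<longlongrightarrow> 0) (at_right 0)"
    using ev by (auto simp: generator_graph_def)
  have TX: "T s v \<in> X" if "s \<ge> 0" "v \<in> X" for s v
    using sg that by (auto simp: c0_semigroup_def)
  have add: "T s (v + w) = T s v + T s w" if "s \<ge> 0" "v \<in> X" "w \<in> X" for s v w
    using sg that by (auto simp: c0_semigroup_def)
  have scale: "T s (r *\<^sub>R v) = r *\<^sub>R T s v" if "s \<ge> 0" "v \<in> X" for s v r
    using sg that by (auto simp: c0_semigroup_def)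
  have diff: "T s (v - w) = T s v - T s w" if "s \<ge> 0" "v \<in> X" "w \<in> X" for s v w
    using add[of s v "(-1) *\<^sub>R w"] scale[of s w "-1"] that X
    by (simp add: subspace_neg)
  have T0: "T 0 x = x"
    using sg x by (auto simp: c0_semigroup_def)
  have semi: "T (s + h) x = T s (T h x)" if "s \<ge> 0" "h \<ge> 0" for s h
    using sg x that by (auto simp: c0_semigroup_def)
  have orbit_cont: "continuous_on {0..} (\<lambda>s. T s x)"
    unfolding continuous_on_def
  proof
    fix s :: real assume "s \<in> {0..}"
    then have s: "s \<ge> 0" by simp
    then have "((\<lambda>r. N (T r x - T s x)) \<longlongrightarrow> 0) (at s within {0..})"
      using sg x by (auto simp: c0_semigroup_def)
    then have "((\<lambda>r. C * N (T r x - T s x)) \<longlongrightarrow> 0) (at s within {0..})"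
      by (rule tendsto_mult_right_zero)
    moreover have "\<forall>\<^sub>F r in at s within {0..}. norm (T r x - T s x) \<le> C * N (T r x - T s x)"
      by (auto simp: eventually_at_filter s intro!: always_eventually bound subspace_diff[OF X] TX x)
    ultimately have "((\<lambda>r. T r x - T s x) \<longlongrightarrow> 0) (at s within {0..})"
      by (rule Lim_null_comparison[rotated])
    then show "((\<lambda>r. T r x) \<longlongrightarrow> T s x) (at s within {0..})"
      by (simp add: LIM_zero_iff)
  qed
  have orbit_deriv: "((\<lambda>s. T s x) has_vector_derivative c *\<^sub>R T s x) (at_right s)"
    if s: "s \<ge> 0" for s
  proof -
    \<comment> \<open>\<open>T s\<close> carries the error \<open>q h\<close> of the difference quotient at \<open>0\<close> to the one at \<open>s\<close>.\<close>
    define q where "q h = (T h x - x) /\<^sub>R h - c *\<^sub>R x" for h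
    have qX: "q h \<in> X" if "h \<ge> 0" for h
      unfolding q_def using that x by (intro subspace_diff subspace_scale X TX) auto
    have "\<exists>B. \<forall>v\<in>X. N (T s v) \<le> B * N v"
      using sg s by (simp add: c0_semigroup_def)
    then obtain B where B: "\<And>v. v \<in> X \<Longrightarrow> N (T s v) \<le> B * N v"
      by blast
    have Tq: "T s (q h) = (T (s + h) x - T s x) /\<^sub>R h - c *\<^sub>R T s x" if "h \<ge> 0" for h
      using that s x by (simp add: q_def diff scale semi TX subspace_diff subspace_scale X)
    have "((\<lambda>h. C * (B * N (q h))) \<longlongrightarrow> 0) (at_right 0)"
      using gen unfolding q_def by (intro tendsto_mult_right_zero)
    moreover have "\<forall>\<^sub>F h in at_right 0. norm (T s (q h)) \<le> C * (B * N (q h))"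
      unfolding eventually_at_filter
    proof (intro always_eventually allI impI)
      fix h :: real assume "h \<in> {0<..}"
      then have h: "q h \<in> X" by (simp add: qX)
      have v: "T s (q h) \<in> X" using h s by (rule TX[rotated])
      show "norm (T s (q h)) \<le> C * (B * N (q h))"
        using bound[OF v] mult_left_mono[OF B[OF h] C] by linarith
    qed
    ultimately have "((\<lambda>h. T s (q h)) \<longlongrightarrow> 0) (at_right 0)"
      by (rule Lim_null_comparison[rotated])
    then have "((\<lambda>h. (T (s + h) x - T s x) /\<^sub>R h - c *\<^sub>R T s x) \<longlongrightarrow> 0) (at_right 0)"
      by (rule Lim_transform_eventually) (auto simp: eventually_at_filter Tq)
    then have "((\<lambda>r. (T r x - T s x) /\<^sub>R (r - s) - c *\<^sub>R T s x) \<longlongrightarrow> 0) (at_right s)"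
      by (subst at_right_to_0) (simp add: filterlim_filtermap add.commute)
    then have "((\<lambda>r. (1 / norm (r - s)) *\<^sub>R (T r x - (T s x + (r - s) *\<^sub>R (c *\<^sub>R T s x))))
        \<longlongrightarrow> 0) (at_right s)"
      by (rule Lim_transform_eventually)
        (auto simp: eventually_at_filter scaleR_diff_right scaleR_add_right divide_inverse)
    then show ?thesis
      unfolding has_vector_derivative_def has_derivative_within
      by (intro conjI bounded_linear_scaleR_left)
  qed
  define g where "g s = exp (- c * s) *\<^sub>R T s x" for s
  have "g t = g 0"
  proof (rule constant_if_right_derivative_zero[OF t])
    show "continuous_on {0..t} g"
      unfolding g_def by (intro continuous_intros continuous_on_subset[OF orbit_cont]) auto
    fix s :: real assume s: "0 \<le> s"
    have "((\<lambda>s. exp (- c * s)) has_real_derivative exp (- c * s) * (- c)) (at_right s)"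
      by (auto intro!: derivative_eq_intros)
    from has_vector_derivative_scaleR[OF this orbit_deriv[OF s]]
    show "(g has_vector_derivative 0) (at_right s)"
      by (simp add: g_def[abs_def] algebra_simps)
  qed
  then have "exp (- c * t) *\<^sub>R T t x = x" by (simp add: g_def T0)
  then have "exp (c * t) *\<^sub>R exp (- c * t) *\<^sub>R T t x = exp (c * t) *\<^sub>R x" by simp
  then show ?thesis by (simp add: exp_minus)
qed

section \<open>Square integrable functions and their classes\<close>

lemma finite_measure_unit_lebesgue: "finite_measure unit_lebesgue"
  by (rule finite_measure_lebesgue_on) simp

lemma continuous_imp_integrable_open_interval:
  fixes f :: "real \<Rightarrow> real"
  assumes "continuous_on {a..b} f"
  shows "integrable (lebesgue_on {a<..<b}) f"
proof -
  have "f absolutely_integrable_on {a..b}"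
    by (rule absolutely_integrable_continuous_real[OF assms])
  then have "f absolutely_integrable_on {a<..<b}"
    by (rule set_integrable_subset) auto
  then show ?thesis
    by (simp add: integrable_restrict_space set_integrable_def)
qed

lemma square_integrable_continuous:
  assumes "continuous_on {0..1} f"
  shows "square_integrable f"
proof -
  have "continuous_on {0..1} (\<lambda>x. (f x)\<^sup>2)" by (intro continuous_intros assms)
  then have "integrable unit_lebesgue (\<lambda>x. (f x)\<^sup>2)"
    by (rule continuous_imp_integrable_open_interval)
  moreover have "f \<in> borel_measurable unit_lebesgue"
    by (rule continuous_imp_measurable_on_sets_lebesgue)
      (auto intro: continuous_on_subset[OF assms])
  ultimately show ?thesis by (simp add: square_integrable_def)
qed

lemma square_integrable_integrable:
  assumes "square_integrable f"
  shows "integrable unit_lebesgue f"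
proof -
  have "square_integrable (\<lambda>_. 1)"
    by (rule square_integrable_continuous) simp
  from square_integrable_mult[OF assms this] show ?thesis by simp
qed

lemma square_integrable_rep_l2 [simp]: "square_integrable (rep_l2 f)"
  using Quotient3_rep_reflp[OF Quotient3_l2, of f] by (simp add: l2_rel_def)

lemma rep_l2_measurable [measurable]: "rep_l2 f \<in> borel_measurable unit_lebesgue"
  using square_integrable_rep_l2[of f] by (simp add: square_integrable_def)

lemma integrable_rep_l2 [simp]: "integrable unit_lebesgue (rep_l2 f)"
  by (simp add: square_integrable_integrable)

lemma abs_l2_eqI: "l2_rel f g \<Longrightarrow> abs_l2 f = abs_l2 g"
  using Quotient3_rel[OF Quotient3_l2, of f g] by simp

lemma rep_abs_l2:
  assumes "square_integrable f"
  shows "AE x in unit_lebesgue. rep_l2 (abs_l2 f) x = f x"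
  using Quotient3_rep_abs[OF Quotient3_l2, of f] assms by (simp add: l2_rel_def)

lemma abs_rep_l2: "abs_l2 (rep_l2 f) = f"
  by (rule Quotient3_abs_rep[OF Quotient3_l2])

lemma l2_eqI:
  assumes "AE x in unit_lebesgue. rep_l2 f x = rep_l2 g x"
  shows "f = g"
  using abs_l2_eqI[of "rep_l2 f" "rep_l2 g"] assms by (simp add: l2_rel_def abs_rep_l2)

lemma rep_l2_add: "AE x in unit_lebesgue. rep_l2 (f + g) x = rep_l2 f x + rep_l2 g x"
  using rep_abs_l2[OF square_integrable_add[of "rep_l2 f" "rep_l2 g"]]
  by (simp add: plus_l2_def)

lemma rep_l2_scaleR: "AE x in unit_lebesgue. rep_l2 (c *\<^sub>R f) x = c * rep_l2 f x"
  using rep_abs_l2[OF square_integrable_scale[of "rep_l2 f" c]]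
  by (simp add: scaleR_l2_def)

lemma rep_l2_zero: "AE x in unit_lebesgue. rep_l2 0 x = 0"
  using rep_abs_l2[OF square_integrable_zero] by (simp add: zero_l2_def)

lemma integral_derivative_subinterval:
  assumes "0 \<le> p" "p \<le> q" "q \<le> 1"
    and F: "\<And>x. (F has_real_derivative f x) (at x)" and f: "continuous_on UNIV f"
  shows "(LINT x|unit_lebesgue. indicator {p<..<q} x * f x) = F q - F p"
proof -
  have "(LINT x|unit_lebesgue. indicator {p<..<q} x * f x) =
      (LINT x|unit_lebesgue. (if x \<in> {p<..<q} then f x else 0))"
    by (rule Bochner_Integration.integral_cong) (auto simp: indicator_def)
  also have "\<dots> = (LINT x|lebesgue_on {p<..<q}. f x)"
    by (rule Lebesgue_Measure.integral_restrict) (use assms in auto)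
  also have "\<dots> = integral {p<..<q} f"
  proof (rule lebesgue_integral_eq_integral)
    have "continuous_on {p..q} f" by (rule continuous_on_subset[OF f]) simp
    then show "integrable (lebesgue_on {p<..<q}) f"
      by (rule continuous_imp_integrable_open_interval)
  qed simp
  also have "\<dots> = integral {p..q} f" by (simp add: integral_open_interval_real)
  also have "\<dots> = F q - F p"
    by (intro integral_unique fundamental_theorem_of_calculus assms)
      (use F in \<open>auto simp: has_real_derivative_iff_has_vector_derivative
        intro: has_vector_derivative_at_within\<close>)
  finally show ?thesis .
qed

lemma integral_derivative_unit:
  assumes "\<And>x. (F has_real_derivative f x) (at x)" and "continuous_on UNIV f"
  shows "(LINT x|unit_lebesgue. f x) = F 1 - F 0"
proof -
  have "(LINT x|unit_lebesgue. f x) = (LINT x|unit_lebesgue. indicator {0<..<1} x * f x)"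
    by (rule Bochner_Integration.integral_cong) auto
  then show ?thesis using integral_derivative_subinterval[OF _ _ _ assms, of 0 1] by simp
qed

section \<open>Test functions and smooth bumps\<close>

lemma test_functionI:
  assumes "\<And>x. (\<phi> has_real_derivative \<phi>' x) (at x)" "continuous_on UNIV \<phi>'"
    and "0 < p" "q < 1" "\<And>x. x \<notin> {p..q} \<Longrightarrow> \<phi> x = 0"
  shows "test_function \<phi> \<phi>'"
proof -
  have "closure {x. \<phi> x \<noteq> 0} \<subseteq> {p..q}"
    by (rule closure_minimal) (use assms(5) in blast, simp)
  then show ?thesis using assms by (auto simp: test_function_def)
qed

text \<open>
  Vanishing outside a compact interval inside \<open>(0,1)\<close> is easier to use than the condition on the
  closure of the support. Enlarging the interval secures \<open>p < q\<close> also for the zero function.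
\<close>

lemma test_functionE:
  assumes "test_function \<phi> \<phi>'"
  obtains p q where "0 < p" "p < q" "q < 1" "\<And>x. x \<notin> {p..q} \<Longrightarrow> \<phi> x = 0"
proof -
  define S where "S = insert (1/2) (closure {x. \<phi> x \<noteq> 0})"
  have S: "S \<subseteq> {0<..<1}" using assms by (auto simp: test_function_def S_def)
  have "bounded S" by (rule bounded_subset[OF _ S]) simp
  moreover have "closed S" by (auto simp: S_def intro: closed_insert)
  ultimately have "compact S" by (simp add: compact_eq_bounded_closed)
  then obtain p q where p: "p \<in> S" "\<And>x. x \<in> S \<Longrightarrow> p \<le> x" and q: "q \<in> S" "\<And>x. x \<in> S \<Longrightarrow> x \<le> q"
    using compact_attains_sup[of S] compact_attains_inf[of S] by (metis S_def insert_not_empty)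
  have out: "\<phi> x = 0" if "x \<notin> {p..q}" for x
  proof (rule ccontr)
    assume "\<phi> x \<noteq> 0"
    then have "x \<in> S" using closure_subset[of "{x. \<phi> x \<noteq> 0}"] by (auto simp: S_def)
    with p q that show False by auto
  qed
  show ?thesis
  proof (rule that[of "p/2" "(q+1)/2"])
    have "0 < p" "q < 1" using p q S by auto
    moreover have "p \<le> q" using p q by auto
    ultimately show "0 < p/2" "p/2 < (q+1)/2" "(q+1)/2 < 1" by auto
    show "\<phi> x = 0" if "x \<notin> {p/2..(q+1)/2}" for x
      using that \<open>0 < p\<close> \<open>q < 1\<close> by (intro out) auto
  qed
qed

lemma test_function_continuous:
  assumes "test_function \<phi> \<phi>'"
  shows "continuous_on A \<phi>" "continuous_on A \<phi>'"
  using assms DERIV_continuous_on[of A \<phi> \<phi>'] continuous_on_subset[of UNIV \<phi>' A]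
  by (auto simp: test_function_def intro: has_field_derivative_at_within)

lemma derivative_positive_part_squared:
  "((\<lambda>x::real. (max 0 x)\<^sup>2) has_real_derivative 2 * max 0 x) (at x)"
proof -
  consider "x < 0" | "x > 0" | "x = 0" by linarith
  then show ?thesis
  proof cases
    case 1
    have "((\<lambda>x. 0) has_real_derivative 0) (at x)" by simp
    then have "((\<lambda>x::real. (max 0 x)\<^sup>2) has_real_derivative 0) (at x)"
      by (rule has_field_derivative_transform_within_open[of _ _ _ "{..<0}"]) (use 1 in auto)
    then show ?thesis using 1 by simp
  next
    case 2
    have "((\<lambda>x. x\<^sup>2) has_real_derivative 2 * x) (at x)" by (auto intro!: derivative_eq_intros)
    then have "((\<lambda>x::real. (max 0 x)\<^sup>2) has_real_derivative 2 * x) (at x)"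
      by (rule has_field_derivative_transform_within_open[of _ _ _ "{0<..}"]) (use 2 in auto)
    then show ?thesis using 2 by simp
  next
    case 3
    have "((\<lambda>h::real. \<bar>h\<bar>) \<longlongrightarrow> 0) (at 0)" by (auto intro!: tendsto_eq_intros)
    then have "((\<lambda>h::real. ((max 0 h)\<^sup>2) / h) \<longlongrightarrow> 0) (at 0)"
      by (rule Lim_null_comparison[rotated])
        (auto intro!: always_eventually simp: max_def power2_eq_square)
    then show ?thesis using 3 by (simp add: has_field_derivative_iff)
  qed
qed

text \<open>
  Squared positive parts make this continuously differentiable, so that it is a test function whenever
  \<open>[p,q]\<close> lies inside \<open>(0,1)\<close>.
\<close>

definition bump :: "real \<Rightarrow> real \<Rightarrow> real \<Rightarrow> real" where
  "bump p q x = (max 0 (x - p))\<^sup>2 * (max 0 (q - x))\<^sup>2"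

definition bump_deriv :: "real \<Rightarrow> real \<Rightarrow> real \<Rightarrow> real" where
  "bump_deriv p q x =
     2 * max 0 (x - p) * (max 0 (q - x))\<^sup>2 - (max 0 (x - p))\<^sup>2 * (2 * max 0 (q - x))"

lemma bump_nonneg: "0 \<le> bump p q x"
  by (simp add: bump_def)

lemma bump_pos: "p < x \<Longrightarrow> x < q \<Longrightarrow> 0 < bump p q x"
  by (simp add: bump_def)

lemma bump_outside: "x \<notin> {p<..<q} \<Longrightarrow> bump p q x = 0"
  by (auto simp: bump_def max_def)

lemma continuous_on_bump: "continuous_on A (bump p q)"
  unfolding bump_def by (intro continuous_intros)

lemma continuous_on_bump_deriv: "continuous_on A (bump_deriv p q)"
  unfolding bump_deriv_def by (intro continuous_intros)

lemma bump_has_real_derivative: "(bump p q has_real_derivative bump_deriv p q x) (at x)"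
proof -
  have 1: "((\<lambda>x. (max 0 (x - p))\<^sup>2) has_real_derivative 2 * max 0 (x - p) * 1) (at x)"
    by (rule DERIV_chain2[OF derivative_positive_part_squared])
      (auto intro!: derivative_eq_intros)
  have 2: "((\<lambda>x. (max 0 (q - x))\<^sup>2) has_real_derivative 2 * max 0 (q - x) * - 1) (at x)"
    by (rule DERIV_chain2[OF derivative_positive_part_squared])
      (auto intro!: derivative_eq_intros)
  show ?thesis
    using DERIV_mult[OF 1 2] by (simp add: bump_def[abs_def] bump_deriv_def algebra_simps)
qed

text \<open>
  As \<open>k\<close> grows, these functions increase from \<open>0\<close> towards the indicator of \<open>(p,q)\<close>.
\<close>

lemma test_function_exp_bump:
  assumes "0 < p" "q < 1"
  shows "test_function (\<lambda>x. 1 - exp (- (k * bump p q x)))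
           (\<lambda>x. exp (- (k * bump p q x)) * (k * bump_deriv p q x))"
  by (rule test_functionI[of _ _ p q])
    (use assms in \<open>auto intro!: derivative_eq_intros bump_has_real_derivative continuous_intros
      continuous_on_bump continuous_on_bump_deriv simp: bump_outside\<close>)

section \<open>The fundamental lemmas of the calculus of variations\<close>

text \<open>
  The sets over which \<open>h\<close> integrates to zero form a Dynkin system containing the open intervals, hence
  they include all Borel sets.
\<close>

lemma AE_zero_if_interval_integrals_zero:
  fixes h :: "real \<Rightarrow> real"
  assumes h: "integrable lborel h" and total: "integral\<^sup>L lborel h = 0"
    and interval: "\<And>p q. (LINT x:{p<..<q}|lborel. h x) = 0"
  shows "AE x in lborel. h x = 0"
proof (rule sigma_finite_measure.density_zero[OF sigma_finite_lborel h])
  have borel: "sets borel = sigma_sets UNIV (range (\<lambda>(a, b). {a<..<b::real}))"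
    by (subst borel_eq_box) (simp add: case_prod_unfold)
  have sets: "B \<in> sets lborel"
    if "B \<in> sigma_sets UNIV (range (\<lambda>(a, b). {a<..<b::real}))" for B
    using that borel by simp
  fix A :: "real set" assume "A \<in> sets lborel"
  then have A: "A \<in> sigma_sets UNIV (range (\<lambda>(a, b). {a<..<b::real}))"
    using borel by simp
  have int: "set_integrable lborel B h" if "B \<in> sets lborel" for B
    unfolding set_integrable_def by (rule integrable_mult_indicator[OF that h])
  have stable: "Int_stable (range (\<lambda>(a, b). {a<..<b::real}))"
  proof (rule Int_stableI, clarify)
    fix a b c d :: real
    show "{a<..<b} \<inter> {c<..<d} \<in> range (\<lambda>(a, b). {a<..<b})"
      by (rule range_eqI[of _ _ "(max a c, min b d)"]) auto
  qed
  have sub: "range (\<lambda>(a, b). {a<..<b::real}) \<subseteq> Pow UNIV" by simp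
  show "(LINT x:A|lborel. h x) = 0"
    using stable sub A
  proof (induction rule: sigma_sets_induct_disjoint)
    case (basic B)
    then show ?case using interval by auto
  next
    case empty
    then show ?case by (simp add: set_lebesgue_integral_def)
  next
    case (compl B)
    have "(LINT x:B \<union> (UNIV - B)|lborel. h x) = (LINT x:B|lborel. h x) + (LINT x:UNIV - B|lborel. h x)"
      using sets[OF compl(1)] by (intro set_integral_Un int) auto
    then show ?case using total compl(2) by (simp add: set_lebesgue_integral_def)
  next
    case (union B)
    have "(LINT x:(\<Union>i. B i)|lborel. h x) = (\<Sum>i. (LINT x:(B i)|lborel. h x))"
    proof (intro lebesgue_integral_countable_add int)
      show B: "B i \<in> sets lborel" for i using union(2) by (intro sets) auto
      show "(\<Union>i. B i) \<in> sets lborel" using B by (intro sets.countable_UN) auto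
    qed (use union(1) in \<open>auto simp: disjoint_family_on_def\<close>)
    then show ?case using union(3) by simp
  qed
qed

text \<open>
  The indicator of an interval is a bounded pointwise limit of test functions, so dominated
  convergence applies.
\<close>

lemma test_functions_separate_intervals:
  assumes h: "integrable unit_lebesgue h"
    and zero: "\<And>\<phi> \<phi>'. test_function \<phi> \<phi>' \<Longrightarrow> (LINT x|unit_lebesgue. h x * \<phi> x) = 0"
    and pq: "0 \<le> p" "q \<le> 1"
  shows "(LINT x|unit_lebesgue. h x * indicator {p<..<q} x) = 0"
proof -
  \<comment> \<open>The interval may touch \<open>0\<close> or \<open>1\<close>; shrinking it by \<open>\<epsilon> n\<close> keeps the supports inside \<open>(0,1)\<close>.\<close>
  define \<epsilon> where "\<epsilon> n = inverse (real (Suc n))" for n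
  define \<phi> where "\<phi> n x = 1 - exp (- (real n * bump (p + \<epsilon> n) (q - \<epsilon> n) x))" for n x
  have \<epsilon>: "\<epsilon> \<longlonglongrightarrow> 0" "\<And>n. \<epsilon> n > 0"
    using LIMSEQ_inverse_real_of_nat by (simp_all add: \<epsilon>_def[abs_def])
  have test: "\<exists>\<phi>'. test_function (\<phi> n) \<phi>'" for n
    unfolding \<phi>_def using test_function_exp_bump[of "p + \<epsilon> n" "q - \<epsilon> n"] pq \<epsilon>(2)[of n]
    by (auto intro!: exI)
  have lim: "(\<lambda>n. \<phi> n x) \<longlonglongrightarrow> indicator {p<..<q} x" for x
  proof (cases "x \<in> {p<..<q}")
    case True
    have "(\<lambda>n. bump (p + \<epsilon> n) (q - \<epsilon> n) x) \<longlonglongrightarrow> bump (p + 0) (q - 0) x"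
      unfolding bump_def by (intro tendsto_intros \<epsilon>)
    then have "LIM n sequentially. bump (p + \<epsilon> n) (q - \<epsilon> n) x * real n :> at_top"
      using bump_pos[of p x q] True
      by (intro filterlim_tendsto_pos_mult_at_top[OF _ _ filterlim_real_sequentially]) auto
    then have "(\<lambda>n. exp (- (real n * bump (p + \<epsilon> n) (q - \<epsilon> n) x))) \<longlonglongrightarrow> 0"
      by (intro filterlim_compose[OF exp_at_bot] filterlim_compose[OF filterlim_uminus_at_bot_at_top])
        (simp add: mult.commute)
    then have "(\<lambda>n. \<phi> n x) \<longlonglongrightarrow> 1 - 0"
      unfolding \<phi>_def by (intro tendsto_intros)
    then show ?thesis using True by simp
  next
    case False
    then have "x \<notin> {p + \<epsilon> n<..<q - \<epsilon> n}" for n using \<epsilon>(2)[of n] by auto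
    then show ?thesis using False by (simp add: \<phi>_def bump_outside)
  qed
  have bound: "\<bar>\<phi> n x\<bar> \<le> 1" for n x
    using bump_nonneg[of "p + \<epsilon> n" "q - \<epsilon> n" x] by (simp add: \<phi>_def abs_le_iff)
  have meas: "\<phi> n \<in> borel_measurable unit_lebesgue" for n
    using test[of n] by (auto intro!: continuous_imp_measurable_on_sets_lebesgue
        dest: test_function_continuous)
  have "(\<lambda>n. LINT x|unit_lebesgue. h x * \<phi> n x)
      \<longlonglongrightarrow> (LINT x|unit_lebesgue. h x * indicator {p<..<q} x)"
  proof (rule integral_dominated_convergence[where w="\<lambda>x. norm (h x)"])
    show "(\<lambda>x. h x * indicator {p<..<q} x) \<in> borel_measurable unit_lebesgue"
      using h pq by (intro borel_measurable_times borel_measurable_indicator)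
        (auto simp: sets_restrict_space_iff)
    show "(\<lambda>x. h x * \<phi> n x) \<in> borel_measurable unit_lebesgue" for n
      using h meas by (intro borel_measurable_times) auto
    show "integrable unit_lebesgue (\<lambda>x. norm (h x))" using h by simp
    show "AE x in unit_lebesgue. (\<lambda>n. h x * \<phi> n x) \<longlonglongrightarrow> h x * indicator {p<..<q} x"
      by (intro always_eventually allI tendsto_intros lim)
    show "AE x in unit_lebesgue. norm (h x * \<phi> n x) \<le> norm (h x)" for n
      using bound mult_left_le[of "\<bar>\<phi> n _\<bar>" "\<bar>h _\<bar>"] by (auto simp: abs_mult)
  qed
  moreover have "(LINT x|unit_lebesgue. h x * \<phi> n x) = 0" for n
    using test[of n] zero by blast
  ultimately show ?thesis using LIMSEQ_unique[OF tendsto_const] by fastforce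
qed

text \<open>
  The fundamental lemma of the calculus of variations. Intervals generate only the Borel sets, so
  \<open>h\<close> is first replaced by a Borel function that agrees with it almost everywhere.
\<close>

lemma AE_zero_if_orthogonal_to_test_functions:
  assumes h: "integrable unit_lebesgue h"
    and zero: "\<And>\<phi> \<phi>'. test_function \<phi> \<phi>' \<Longrightarrow> (LINT x|unit_lebesgue. h x * \<phi> x) = 0"
  shows "AE x in unit_lebesgue. h x = 0"
proof -
  define H where "H x = indicator {0<..<1} x * h x" for x
  have H: "integrable lebesgue H"
    using h by (simp add: integrable_restrict_space H_def[abs_def])
  then obtain h' where h': "h' \<in> borel_measurable lborel" and eq: "AE x in lborel. H x = h' x"
    using completion_ex_borel_measurable_real[of H lborel] by blast
  then have eq': "AE x in lebesgue. H x = h' x" by (simp add: AE_completion)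
  have h'_leb: "h' \<in> borel_measurable lebesgue" using h' by (rule measurable_completion)
  have int_leb: "integrable lebesgue h'"
    using H eq' h'_leb integrable_cong_AE by (metis borel_measurable_integrable)
  then have int: "integrable lborel h'"
    using h' by (simp add: integrable_completion)
  have transfer: "(LINT x|lborel. indicator A x * h' x) = (LINT x|unit_lebesgue. h x * indicator A x)"
    if A: "A \<in> sets borel" for A
  proof -
    have "(LINT x|lborel. indicator A x * h' x) = (LINT x|lebesgue. indicator A x * h' x)"
      using h' A by (intro integral_completion[symmetric] borel_measurable_times borel_measurable_indicator) auto
    also have "\<dots> = (LINT x|lebesgue. indicator {0<..<1} x *\<^sub>R (h x * indicator A x))"
    proof (rule integral_cong_AE)
      show "(\<lambda>x. indicator A x * h' x) \<in> borel_measurable lebesgue"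
        using h'_leb A by (intro borel_measurable_times borel_measurable_indicator) auto
      have "(\<lambda>x. indicator A x * H x) \<in> borel_measurable lebesgue"
        using H A by (intro borel_measurable_times borel_measurable_indicator) auto
      then show "(\<lambda>x. indicator {0<..<1} x *\<^sub>R (h x * indicator A x)) \<in> borel_measurable lebesgue"
        by (simp add: H_def algebra_simps)
      show "AE x in lebesgue. indicator A x * h' x = indicator {0<..<1} x *\<^sub>R (h x * indicator A x)"
        using eq' by eventually_elim (auto simp: H_def indicator_def split: if_splits)
    qed
    also have "\<dots> = (LINT x|unit_lebesgue. h x * indicator A x)"
      by (rule integral_restrict_space[symmetric]) simp
    finally show ?thesis .
  qed
  have inter: "(LINT x|unit_lebesgue. h x * indicator {p<..<q} x) = 0" for p q
  proof -
    have "(LINT x|unit_lebesgue. h x * indicator {p<..<q} x)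
        = (LINT x|unit_lebesgue. h x * indicator {max 0 p<..<min 1 q} x)"
      by (rule Bochner_Integration.integral_cong) (auto simp: indicator_def)
    then show ?thesis using test_functions_separate_intervals[OF h zero] by simp
  qed
  have "AE x in lborel. h' x = 0"
  proof (rule AE_zero_if_interval_integrals_zero[OF int])
    have "(LINT x|unit_lebesgue. h x * indicator UNIV x)
        = (LINT x|unit_lebesgue. h x * indicator {0<..<1} x)"
      by (rule Bochner_Integration.integral_cong) auto
    then show "integral\<^sup>L lborel h' = 0" using transfer[of UNIV] inter[of 0 1] by simp
    show "(LINT x:{p<..<q}|lborel. h' x) = 0" for p q
      using transfer[of "{p<..<q}"] inter by (simp add: set_lebesgue_integral_def)
  qed
  with eq have "AE x in lborel. H x = 0" by eventually_elim simp
  then have "AE x in lebesgue. H x = 0" by (rule AE_completion)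
  then have "AE x in lebesgue. x \<in> {0<..<1} \<longrightarrow> h x = 0"
    by eventually_elim (auto simp: H_def)
  then show ?thesis by (simp add: AE_restrict_space_iff)
qed

lemma integrable_test_mult:
  fixes f \<phi> :: "real \<Rightarrow> real"
  assumes f: "integrable unit_lebesgue f" and \<phi>: "continuous_on {0..1} \<phi>"
  shows "integrable unit_lebesgue (\<lambda>x. f x * \<phi> x)"
proof -
  have "compact (\<phi> ` {0..1})" by (intro compact_continuous_image \<phi>) simp
  then obtain B where B: "\<And>x. x \<in> {0..1} \<Longrightarrow> \<bar>\<phi> x\<bar> \<le> B"
    using compact_imp_bounded bounded_iff by (metis image_eqI real_norm_def)
  show ?thesis
  proof (rule Bochner_Integration.integrable_bound)
    show "integrable unit_lebesgue (\<lambda>x. B * f x)" using f by simp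
    show "(\<lambda>x. f x * \<phi> x) \<in> borel_measurable unit_lebesgue"
      using \<phi> by (intro borel_measurable_times borel_measurable_integrable[OF f]
          continuous_imp_measurable_on_sets_lebesgue) (auto intro: continuous_on_subset)
    show "AE x in unit_lebesgue. norm (f x * \<phi> x) \<le> norm (B * f x)"
    proof (rule AE_I2)
      fix x assume "x \<in> space unit_lebesgue"
      then have "\<bar>\<phi> x\<bar> \<le> \<bar>B\<bar>" using B[of x] by auto
      then show "norm (f x * \<phi> x) \<le> norm (B * f x)"
        by (simp add: abs_mult mult.commute mult_right_mono)
    qed
  qed
qed

text \<open>
  A primitive is constant to the left and to the right of the support of \<open>\<psi>\<close>, and the vanishing
  integral makes both constants equal.
\<close>

lemma test_function_primitive:
  assumes \<psi>: "test_function \<psi> \<psi>'" and zero: "(LINT x|unit_lebesgue. \<psi> x) = 0"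
  obtains \<phi> where "test_function \<phi> \<psi>"
proof -
  obtain p q where pq: "0 < p" "p < q" "q < 1" and out: "\<And>x. x \<notin> {p..q} \<Longrightarrow> \<psi> x = 0"
    using test_functionE[OF \<psi>] by metis
  have cont: "continuous_on UNIV \<psi>" by (rule test_function_continuous[OF \<psi>])
  then obtain F where F: "\<And>x. (F has_real_derivative \<psi> x) (at x)"
    using einterval_antiderivative[of "-\<infinity>" "\<infinity>" \<psi>]
    by (auto simp: has_real_derivative_iff_has_vector_derivative continuous_on_eq_continuous_at)
  have const: "F x = F y" if "\<And>z. z \<in> {min x y<..<max x y} \<Longrightarrow> \<psi> z = 0" for x y
  proof -
    have *: "F y = F x" if "x \<le> y" "\<And>z. z \<in> {x<..<y} \<Longrightarrow> \<psi> z = 0" for x y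
    proof (cases "x = y")
      case False
      with that obtain z where "x < z" "z < y" "F y - F x = (y - x) * \<psi> z"
        using MVT2[of x y F \<psi>] F by auto
      then show ?thesis using that(2)[of z] by simp
    qed simp
    show ?thesis using *[of x y] *[of y x] that by (cases "x \<le> y") auto
  qed
  have F01: "F 1 = F 0" using integral_derivative_unit[OF F cont] zero by simp
  have "test_function (\<lambda>x. F x - F 0) \<psi>"
  proof (rule test_functionI[of _ _ p q])
    show "((\<lambda>x. F x - F 0) has_real_derivative \<psi> x) (at x)" for x
      using F by (auto intro!: derivative_eq_intros)
    fix x assume x: "x \<notin> {p..q}"
    show "F x - F 0 = 0"
    proof (cases "x < p")
      case True
      then have "\<psi> z = 0" if "z \<in> {min x 0<..<max x 0}" for z
        using that pq by (intro out) auto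
      then show ?thesis using const[of x 0] by simp
    next
      case False
      then have "\<psi> z = 0" if "z \<in> {min x 1<..<max x 1}" for z
        using that pq x by (intro out) auto
      then show ?thesis using const[of x 1] F01 by simp
    qed
  qed (use cont pq in auto)
  then show ?thesis by (rule that)
qed

text \<open>
  The lemma of du Bois-Reymond. Subtracting from a test function the right multiple of a fixed one with integral
  \<open>1\<close> leaves a derivative of a test function, so \<open>f - c\<close> is orthogonal to all test functions
  when \<open>c\<close> is the integral of \<open>f\<close> against the fixed one.
\<close>

lemma AE_constant_if_orthogonal_to_derivatives:
  assumes f: "integrable unit_lebesgue f"
    and zero: "\<And>\<phi> \<phi>'. test_function \<phi> \<phi>' \<Longrightarrow> (LINT x|unit_lebesgue. f x * \<phi>' x) = 0"
  obtains c where "AE x in unit_lebesgue. f x = c"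
proof -
  define I where "I = (LINT x|unit_lebesgue. bump (1/4) (3/4) x)"
  have bump_int: "integrable unit_lebesgue (bump (1/4) (3/4))"
    by (intro square_integrable_integrable square_integrable_continuous continuous_on_bump)
  have "I \<noteq> 0"
  proof
    assume "I = 0"
    then have "AE x in unit_lebesgue. bump (1/4) (3/4) x = 0"
      using integral_nonneg_eq_0_iff_AE[OF bump_int] by (simp add: I_def bump_nonneg)
    then have "AE x in lebesgue. x \<in> {0<..<1} \<longrightarrow> bump (1/4) (3/4) x = 0"
      by (simp add: AE_restrict_space_iff)
    then have "AE x in lebesgue. x \<notin> {1/4<..<3/4::real}"
      by eventually_elim (use bump_pos[of "1/4" _ "3/4"] in force)
    then have "{1/4<..<3/4::real} \<in> null_sets lebesgue"
      by (subst AE_iff_null_sets) auto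
    then show False
      using open_not_negligible[of "{1/4<..<3/4::real}"] by (simp add: negligible_iff_null_sets)
  qed
  define \<psi>0 where "\<psi>0 x = bump (1/4) (3/4) x / I" for x
  define \<psi>0' where "\<psi>0' x = bump_deriv (1/4) (3/4) x / I" for x
  have test0: "test_function \<psi>0 \<psi>0'"
    unfolding \<psi>0_def \<psi>0'_def
    by (rule test_functionI[of _ _ "1/4" "3/4"])
      (use \<open>I \<noteq> 0\<close> in \<open>auto intro!: DERIV_cdivide bump_has_real_derivative continuous_intros
        continuous_on_bump_deriv simp: bump_outside\<close>)
  have int0: "(LINT x|unit_lebesgue. \<psi>0 x) = 1" and int0': "integrable unit_lebesgue \<psi>0"
    using \<open>I \<noteq> 0\<close> bump_int by (simp_all add: \<psi>0_def[abs_def] I_def)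
  define c where "c = (LINT x|unit_lebesgue. f x * \<psi>0 x)"
  have "AE x in unit_lebesgue. f x - c = 0"
  proof (rule AE_zero_if_orthogonal_to_test_functions)
    show "integrable unit_lebesgue (\<lambda>x. f x - c)"
      by (intro Bochner_Integration.integrable_diff f
          finite_measure.integrable_const[OF finite_measure_unit_lebesgue])
    fix \<psi> \<psi>' assume \<psi>: "test_function \<psi> \<psi>'"
    define J where "J = (LINT x|unit_lebesgue. \<psi> x)"
    have int: "integrable unit_lebesgue \<psi>"
      by (intro square_integrable_integrable square_integrable_continuous
          test_function_continuous[OF \<psi>])
    have f\<psi>: "integrable unit_lebesgue (\<lambda>x. f x * \<psi> x)"
      by (intro integrable_test_mult f test_function_continuous[OF \<psi>])
    have f\<psi>0: "integrable unit_lebesgue (\<lambda>x. f x * \<psi>0 x)"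
      by (intro integrable_test_mult f test_function_continuous[OF test0])
    obtain p q where pq: "0 < p" "p < q" "q < 1" "\<And>x. x \<notin> {p..q} \<Longrightarrow> \<psi> x = 0"
      using test_functionE[OF \<psi>] by metis
    have "test_function (\<lambda>x. \<psi> x - J * \<psi>0 x) (\<lambda>x. \<psi>' x - J * \<psi>0' x)"
    proof (rule test_functionI[of _ _ "min p (1/4)" "max q (3/4)"])
      show "((\<lambda>x. \<psi> x - J * \<psi>0 x) has_real_derivative \<psi>' x - J * \<psi>0' x) (at x)" for x
        using \<psi> test0 by (intro DERIV_diff DERIV_cmult) (auto simp: test_function_def)
      show "continuous_on UNIV (\<lambda>x. \<psi>' x - J * \<psi>0' x)"
        by (intro continuous_intros test_function_continuous(2)[OF \<psi>]
            test_function_continuous(2)[OF test0])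
      fix x assume "x \<notin> {min p (1/4)..max q (3/4)}"
      then have "x \<notin> {p..q}" "x \<notin> {1/4<..<3/4}" by auto
      then show "\<psi> x - J * \<psi>0 x = 0" using pq by (simp add: \<psi>0_def bump_outside)
    qed (use pq in auto)
    moreover have "(LINT x|unit_lebesgue. \<psi> x - J * \<psi>0 x) = 0"
      using int int0 int0' by (simp add: J_def)
    ultimately obtain \<phi> where "test_function \<phi> (\<lambda>x. \<psi> x - J * \<psi>0 x)"
      using test_function_primitive by blast
    then have "(LINT x|unit_lebesgue. f x * (\<psi> x - J * \<psi>0 x)) = 0" by (rule zero)
    also have "(\<lambda>x. f x * (\<psi> x - J * \<psi>0 x)) = (\<lambda>x. f x * \<psi> x - J * (f x * \<psi>0 x))"
      by (simp add: algebra_simps)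
    finally have "(LINT x|unit_lebesgue. f x * \<psi> x) = J * c"
      using f\<psi> f\<psi>0 by (simp add: c_def)
    moreover have "(LINT x|unit_lebesgue. (f x - c) * \<psi> x)
        = (LINT x|unit_lebesgue. f x * \<psi> x) - c * J"
      using f\<psi> int by (simp add: left_diff_distrib J_def)
    ultimately show "(LINT x|unit_lebesgue. (f x - c) * \<psi> x) = 0" by simp
  qed
  then have "AE x in unit_lebesgue. f x = c" by simp
  then show ?thesis by (rule that)
qed

section \<open>Weak derivatives\<close>

lemma weak_deriv_unique:
  assumes "has_weak_deriv f g" "has_weak_deriv f g'"
  shows "g = g'"
proof (rule l2_eqI)
  have "AE x in unit_lebesgue. rep_l2 g x - rep_l2 g' x = 0"
  proof (rule AE_zero_if_orthogonal_to_test_functions)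
    fix \<phi> \<phi>' assume \<phi>: "test_function \<phi> \<phi>'"
    have "integrable unit_lebesgue (\<lambda>x. rep_l2 h x * \<phi> x)" for h
      by (intro integrable_test_mult integrable_rep_l2 test_function_continuous[OF \<phi>])
    moreover have "(LINT x|unit_lebesgue. rep_l2 f x * \<phi>' x) = - (LINT x|unit_lebesgue. rep_l2 h x * \<phi> x)"
      if "has_weak_deriv f h" for h
      using that \<phi> unfolding has_weak_deriv_def by blast
    from this[OF assms(1)] this[OF assms(2)]
    have "(LINT x|unit_lebesgue. rep_l2 g x * \<phi> x) = (LINT x|unit_lebesgue. rep_l2 g' x * \<phi> x)"
      by simp
    ultimately show "(LINT x|unit_lebesgue. (rep_l2 g x - rep_l2 g' x) * \<phi> x) = 0"
      by (simp add: left_diff_distrib)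
  qed simp
  then show "AE x in unit_lebesgue. rep_l2 g x = rep_l2 g' x" by simp
qed

lemma weak_deriv_eqI: "has_weak_deriv f g \<Longrightarrow> weak_deriv f = g"
  unfolding weak_deriv_def by (blast intro: weak_deriv_unique)

lemma has_weak_deriv_add:
  assumes "has_weak_deriv f g" "has_weak_deriv f' g'"
  shows "has_weak_deriv (f + f') (g + g')"
  unfolding has_weak_deriv_def
proof (intro allI impI)
  fix \<phi> \<phi>' assume \<phi>: "test_function \<phi> \<phi>'"
  have int: "integrable unit_lebesgue (\<lambda>x. rep_l2 h x * \<phi> x)"
    "integrable unit_lebesgue (\<lambda>x. rep_l2 h x * \<phi>' x)" for h
    by (intro integrable_test_mult integrable_rep_l2 test_function_continuous[OF \<phi>])+
  have add: "(LINT x|unit_lebesgue. rep_l2 (h + k) x * \<rho> x) =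
      (LINT x|unit_lebesgue. rep_l2 h x * \<rho> x) + (LINT x|unit_lebesgue. rep_l2 k x * \<rho> x)"
    if "\<And>h. integrable unit_lebesgue (\<lambda>x. rep_l2 h x * \<rho> x)" for h k \<rho>
  proof -
    have "(LINT x|unit_lebesgue. rep_l2 (h + k) x * \<rho> x) =
        (LINT x|unit_lebesgue. rep_l2 h x * \<rho> x + rep_l2 k x * \<rho> x)"
    proof (rule integral_cong_AE)
      show "AE x in unit_lebesgue. rep_l2 (h + k) x * \<rho> x = rep_l2 h x * \<rho> x + rep_l2 k x * \<rho> x"
        using rep_l2_add[of h k] by eventually_elim (simp add: distrib_right)
    qed (use that in \<open>auto intro!: borel_measurable_add borel_measurable_integrable\<close>)
    then show ?thesis using that by simp
  qed
  show "(LINT x|unit_lebesgue. rep_l2 (f + f') x * \<phi>' x)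
      = - (LINT x|unit_lebesgue. rep_l2 (g + g') x * \<phi> x)"
    using assms \<phi> by (simp add: add int has_weak_deriv_def)
qed

lemma has_weak_deriv_scaleR:
  assumes "has_weak_deriv f g"
  shows "has_weak_deriv (c *\<^sub>R f) (c *\<^sub>R g)"
  unfolding has_weak_deriv_def
proof (intro allI impI)
  fix \<phi> \<phi>' assume \<phi>: "test_function \<phi> \<phi>'"
  have int: "integrable unit_lebesgue (\<lambda>x. rep_l2 h x * \<phi> x)"
    "integrable unit_lebesgue (\<lambda>x. rep_l2 h x * \<phi>' x)" for h
    by (intro integrable_test_mult integrable_rep_l2 test_function_continuous[OF \<phi>])+
  have scale: "(LINT x|unit_lebesgue. rep_l2 (c *\<^sub>R h) x * \<rho> x) =
      c * (LINT x|unit_lebesgue. rep_l2 h x * \<rho> x)"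
    if "\<And>h. integrable unit_lebesgue (\<lambda>x. rep_l2 h x * \<rho> x)" for h \<rho>
  proof -
    have "(LINT x|unit_lebesgue. rep_l2 (c *\<^sub>R h) x * \<rho> x) =
        (LINT x|unit_lebesgue. c * (rep_l2 h x * \<rho> x))"
    proof (rule integral_cong_AE)
      show "AE x in unit_lebesgue. rep_l2 (c *\<^sub>R h) x * \<rho> x = c * (rep_l2 h x * \<rho> x)"
        using rep_l2_scaleR[of c h] by eventually_elim simp
    qed (use that in \<open>auto intro!: borel_measurable_times borel_measurable_integrable\<close>)
    then show ?thesis by simp
  qed
  show "(LINT x|unit_lebesgue. rep_l2 (c *\<^sub>R f) x * \<phi>' x)
      = - (LINT x|unit_lebesgue. rep_l2 (c *\<^sub>R g) x * \<phi> x)"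
    using assms \<phi> by (simp add: scale int has_weak_deriv_def)
qed

lemma has_weak_deriv_zero: "has_weak_deriv 0 0"
proof -
  have "(LINT x|unit_lebesgue. rep_l2 0 x * \<rho> x) = 0" for \<rho>
    by (rule integral_eq_zero_AE) (use rep_l2_zero in \<open>auto elim: eventually_mono\<close>)
  then show ?thesis by (simp add: has_weak_deriv_def)
qed

lemma subspace_H1: "subspace H1"
  unfolding subspace_def H1_def
  using has_weak_deriv_zero has_weak_deriv_add has_weak_deriv_scaleR by blast

section \<open>Point values\<close>

text \<open>
  The set in \<open>(0,1)\<close> where two continuous functions differ is open, hence empty if it is a null set; the
  end points follow by continuity.
\<close>

lemma continuous_eq_if_AE_eq:
  fixes g h :: "real \<Rightarrow> real"
  assumes g: "continuous_on {0..1} g" and h: "continuous_on {0..1} h"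
    and eq: "AE x in unit_lebesgue. g x = h x" and x: "x \<in> {0..1}"
  shows "g x = h x"
proof -
  define S where "S = {x \<in> {0<..<1}. g x - h x \<noteq> 0}"
  have "continuous_on {0<..<1} (\<lambda>x. g x - h x)"
    by (intro continuous_intros continuous_on_subset[OF g] continuous_on_subset[OF h]) auto
  then have "open ({0<..<1} \<inter> (\<lambda>x. g x - h x) -` (- {0}))"
    by (rule continuous_open_preimage) auto
  then have "open S" by (simp add: S_def vimage_def Int_def)
  have "AE x in lebesgue. x \<in> {0<..<1} \<longrightarrow> g x = h x"
    using eq by (simp add: AE_restrict_space_iff)
  then have "AE x in lebesgue. x \<notin> S" by eventually_elim (auto simp: S_def)
  then have "S \<in> null_sets lebesgue"
    using \<open>open S\<close> by (subst AE_iff_null_sets) auto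
  then have "negligible S" by (simp add: negligible_iff_null_sets)
  with \<open>open S\<close> have "S = {}" using open_not_negligible by blast
  then have zero: "g y - h y = 0" if "y \<in> {0<..<1}" for y using that by (auto simp: S_def)
  have "continuous_on (closure {0<..<1::real}) (\<lambda>x. g x - h x)"
    using g h by (auto intro!: continuous_intros)
  from continuous_constant_on_closure[OF this zero, of x] x
  show ?thesis by simp
qed

lemma pt_value_eqI:
  assumes "continuous_on {0..1} g" "AE s in unit_lebesgue. rep_l2 f s = g s" "x \<in> {0..1}"
  shows "pt_value f x = g x"
  unfolding pt_value_def
proof (rule the_equality)
  show "\<exists>h. continuous_on {0..1} h \<and> (AE s in unit_lebesgue. rep_l2 f s = h s) \<and> h x = g x"
    using assms by blast
next
  fix c assume "\<exists>h. continuous_on {0..1} h \<and> (AE s in unit_lebesgue. rep_l2 f s = h s) \<and> h x = c"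
  then obtain h where h: "continuous_on {0..1} h" "AE s in unit_lebesgue. rep_l2 f s = h s" "h x = c"
    by blast
  have "AE s in unit_lebesgue. h s = g s"
    using h(2) assms(2) by eventually_elim simp
  from continuous_eq_if_AE_eq[OF h(1) assms(1) this assms(3)] h(3) show "c = g x" by simp
qed

text \<open>
  Integration by parts for the primitive of a merely integrable function, obtained by exchanging the order of
  integration over the triangle \<open>s < x\<close>.
\<close>

lemma primitive_integration_by_parts:
  fixes g :: "real \<Rightarrow> real"
  assumes g: "integrable unit_lebesgue g" and \<phi>: "test_function \<phi> \<phi>'"
  shows "(LINT x|unit_lebesgue. (LINT s|unit_lebesgue. indicator {..<x} s * g s) * \<phi>' x) =
    - (LINT s|unit_lebesgue. g s * \<phi> s)"
proof -
  interpret finite_measure unit_lebesgue by (rule finite_measure_unit_lebesgue)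
  interpret pair_sigma_finite unit_lebesgue unit_lebesgue by unfold_locales
  define k where "k s x = indicator {..<x} s * g s * \<phi>' x" for s x :: real
  have g_meas [measurable]: "g \<in> borel_measurable unit_lebesgue" using g by simp
  have \<phi>'_cont: "continuous_on {0..1} \<phi>'" by (rule test_function_continuous[OF \<phi>])
  have \<phi>'_int: "integrable unit_lebesgue \<phi>'"
    by (intro square_integrable_integrable square_integrable_continuous \<phi>'_cont)
  then have \<phi>'_meas [measurable]: "\<phi>' \<in> borel_measurable unit_lebesgue" by simp
  have id_meas [measurable]: "(\<lambda>x. x) \<in> borel_measurable unit_lebesgue"
    by (intro continuous_imp_measurable_on_sets_lebesgue continuous_intros) simp
  have k_meas: "case_prod k \<in> borel_measurable (unit_lebesgue \<Otimes>\<^sub>M unit_lebesgue)"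
  proof -
    have "(\<lambda>z. fst z) \<in> borel_measurable (unit_lebesgue \<Otimes>\<^sub>M unit_lebesgue)"
      "(\<lambda>z. snd z) \<in> borel_measurable (unit_lebesgue \<Otimes>\<^sub>M unit_lebesgue)"
      using measurable_compose[OF measurable_fst id_meas] measurable_compose[OF measurable_snd id_meas]
      by auto
    then have "Measurable.pred (unit_lebesgue \<Otimes>\<^sub>M unit_lebesgue) (\<lambda>z. fst z < snd z)"
      by (intro borel_measurable_pred_less)
    then have "(\<lambda>z. (if fst z < snd z then 1 else 0) * g (fst z) * \<phi>' (snd z))
        \<in> borel_measurable (unit_lebesgue \<Otimes>\<^sub>M unit_lebesgue)"
      by measurable
    also have "(\<lambda>z. (if fst z < snd z then 1 else 0) * g (fst z) * \<phi>' (snd z)) = case_prod k"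
      by (auto simp: k_def indicator_def fun_eq_iff)
    finally show ?thesis .
  qed
  have prod_int: "integrable (unit_lebesgue \<Otimes>\<^sub>M unit_lebesgue) (\<lambda>z. g (fst z) * \<phi>' (snd z))"
    using g \<phi>'_int by (intro Fubini_integrable) (auto simp: abs_mult)
  have "integrable (unit_lebesgue \<Otimes>\<^sub>M unit_lebesgue) (case_prod k)"
    by (rule Bochner_Integration.integrable_bound[OF prod_int k_meas])
      (auto simp: k_def indicator_def intro!: always_eventually)
  from Fubini_integral[OF this]
  have "(LINT x|unit_lebesgue. LINT s|unit_lebesgue. k s x)
      = (LINT s|unit_lebesgue. LINT x|unit_lebesgue. k s x)" .
  also have "(LINT x|unit_lebesgue. LINT s|unit_lebesgue. k s x) =
      (LINT x|unit_lebesgue. (LINT s|unit_lebesgue. indicator {..<x} s * g s) * \<phi>' x)"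
    by (simp add: k_def)
  also have "(LINT s|unit_lebesgue. LINT x|unit_lebesgue. k s x) =
      (LINT s|unit_lebesgue. - (g s * \<phi> s))"
  proof (rule Bochner_Integration.integral_cong[OF refl])
    fix s assume "s \<in> space unit_lebesgue"
    then have s: "0 < s" "s < 1" by auto
    have der: "(\<phi> has_real_derivative \<phi>' x) (at x)" for x
      using \<phi> by (simp add: test_function_def)
    obtain p q where "0 < p" "p < q" "q < 1" "\<And>x. x \<notin> {p..q} \<Longrightarrow> \<phi> x = 0"
      using test_functionE[OF \<phi>] by metis
    then have "\<phi> 1 = 0" by auto
    have "(LINT x|unit_lebesgue. k s x)
        = (LINT x|unit_lebesgue. g s * (indicator {s<..<1} x * \<phi>' x))"
      by (rule Bochner_Integration.integral_cong) (auto simp: k_def indicator_def)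
    also have "\<dots> = g s * (\<phi> 1 - \<phi> s)"
      using s by (simp add: integral_derivative_subinterval[OF _ _ _ der test_function_continuous(2)[OF \<phi>]])
    finally show "(LINT x|unit_lebesgue. k s x) = - (g s * \<phi> s)"
      using \<open>\<phi> 1 = 0\<close> by simp
  qed
  finally show ?thesis by simp
qed

lemma continuous_on_primitive:
  fixes g :: "real \<Rightarrow> real"
  assumes g: "integrable unit_lebesgue g"
  shows "continuous_on {0..1} (\<lambda>x. LINT s|unit_lebesgue. indicator {..<x} s * g s)"
proof -
  have "(LINT s|unit_lebesgue. indicator {..<x} s * g s) = integral {0..x} g" if x: "x \<in> {0..1}" for x
  proof -
    have int: "integrable unit_lebesgue (\<lambda>s. indicator {..<x} s * g s)"
    proof (rule Bochner_Integration.integrable_bound[OF g])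
      show "(\<lambda>s. indicator {..<x} s * g s) \<in> borel_measurable unit_lebesgue"
        by (intro borel_measurable_times measurable_restrict_space1 borel_measurable_indicator
            borel_measurable_integrable[OF g]) auto
    qed (auto simp: indicator_def)
    have "(LINT s|unit_lebesgue. indicator {..<x} s * g s)
        = integral {0<..<1} (\<lambda>s. indicator {..<x} s * g s)"
      using int by (rule lebesgue_integral_eq_integral) simp
    also have "\<dots> = integral {0<..<1} (\<lambda>s. if s \<in> {..<x} then g s else 0)"
      by (rule Henstock_Kurzweil_Integration.integral_cong) auto
    also have "\<dots> = integral ({..<x} \<inter> {0<..<1}) g"
      by (rule Henstock_Kurzweil_Integration.integral_restrict_Int)
    also have "{..<x} \<inter> {0<..<1} = {0<..<x}" using x by auto
    finally show ?thesis by (simp add: integral_open_interval_real)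
  qed
  moreover have "g integrable_on {0..1}"
    using integrable_on_lebesgue_on[OF g] by (simp add: integrable_on_open_interval_real)
  ultimately show ?thesis
    using continuous_on_eq[OF indefinite_integral_continuous_1[of g 0 1]] by simp
qed

text \<open>
  By \<open>primitive_integration_by_parts\<close>, the primitive of the weak derivative has the same weak derivative, so the
  difference from \<open>f\<close> is orthogonal to all derivatives of test functions and thus constant.
\<close>

lemma H1_continuous_representative:
  assumes "f \<in> H1"
  obtains G where "continuous_on {0..1} G" "AE x in unit_lebesgue. rep_l2 f x = G x"
proof -
  obtain g where g: "has_weak_deriv f g" using assms by (auto simp: H1_def)
  define G where "G x = (LINT s|unit_lebesgue. indicator {..<x} s * rep_l2 g s)" for x
  have G: "continuous_on {0..1} G"
    unfolding G_def by (rule continuous_on_primitive) simp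
  then have G_int: "integrable unit_lebesgue G"
    by (intro square_integrable_integrable square_integrable_continuous)
  obtain c where c: "AE x in unit_lebesgue. rep_l2 f x - G x = c"
  proof (rule AE_constant_if_orthogonal_to_derivatives)
    show "integrable unit_lebesgue (\<lambda>x. rep_l2 f x - G x)" using G_int by simp
    fix \<phi> \<phi>' assume \<phi>: "test_function \<phi> \<phi>'"
    have int: "integrable unit_lebesgue (\<lambda>x. rep_l2 f x * \<phi>' x)"
      "integrable unit_lebesgue (\<lambda>x. G x * \<phi>' x)"
      by (intro integrable_test_mult G_int integrable_rep_l2 test_function_continuous[OF \<phi>])+
    have "(LINT x|unit_lebesgue. rep_l2 f x * \<phi>' x) = - (LINT x|unit_lebesgue. rep_l2 g x * \<phi> x)"
      using g \<phi> by (auto simp: has_weak_deriv_def)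
    moreover have "(LINT x|unit_lebesgue. G x * \<phi>' x) = - (LINT x|unit_lebesgue. rep_l2 g x * \<phi> x)"
      unfolding G_def by (rule primitive_integration_by_parts[OF _ \<phi>]) simp
    ultimately show "(LINT x|unit_lebesgue. (rep_l2 f x - G x) * \<phi>' x) = 0"
      using int by (simp add: left_diff_distrib)
  qed
  show ?thesis
  proof (rule that[of "\<lambda>x. G x + c"])
    show "continuous_on {0..1} (\<lambda>x. G x + c)" by (intro continuous_intros G)
    show "AE x in unit_lebesgue. rep_l2 f x = G x + c" using c by eventually_elim simp
  qed
qed

lemma pt_value_add:
  assumes "f \<in> H1" "g \<in> H1" "x \<in> {0..1}"
  shows "pt_value (f + g) x = pt_value f x + pt_value g x"
proof -
  obtain F G where F: "continuous_on {0..1} F" "AE x in unit_lebesgue. rep_l2 f x = F x"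
    and G: "continuous_on {0..1} G" "AE x in unit_lebesgue. rep_l2 g x = G x"
    using H1_continuous_representative assms by metis
  have "AE x in unit_lebesgue. rep_l2 (f + g) x = F x + G x"
    using F(2) G(2) rep_l2_add[of f g] by eventually_elim simp
  then have "pt_value (f + g) x = F x + G x"
    using assms(3) by (intro pt_value_eqI continuous_intros F G)
  then show ?thesis using pt_value_eqI[OF F assms(3)] pt_value_eqI[OF G assms(3)] by simp
qed

lemma pt_value_scaleR:
  assumes "f \<in> H1" "x \<in> {0..1}"
  shows "pt_value (c *\<^sub>R f) x = c * pt_value f x"
proof -
  obtain F where F: "continuous_on {0..1} F" "AE x in unit_lebesgue. rep_l2 f x = F x"
    using H1_continuous_representative assms by metis
  have "AE x in unit_lebesgue. rep_l2 (c *\<^sub>R f) x = c * F x"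
    using F(2) rep_l2_scaleR[of c f] by eventually_elim simp
  then have "pt_value (c *\<^sub>R f) x = c * F x"
    using assms(2) by (intro pt_value_eqI continuous_intros F)
  then show ?thesis using pt_value_eqI[OF F assms(2)] by simp
qed

lemma integral_rep_l2_add:
  "(LINT x|unit_lebesgue. rep_l2 (f + g) x) =
     (LINT x|unit_lebesgue. rep_l2 f x) + (LINT x|unit_lebesgue. rep_l2 g x)"
proof -
  have "(LINT x|unit_lebesgue. rep_l2 (f + g) x) = (LINT x|unit_lebesgue. rep_l2 f x + rep_l2 g x)"
    by (rule integral_cong_AE) (auto intro: rep_l2_add borel_measurable_add rep_l2_measurable)
  then show ?thesis by simp
qed

lemma integral_rep_l2_scaleR:
  "(LINT x|unit_lebesgue. rep_l2 (c *\<^sub>R f) x) = c * (LINT x|unit_lebesgue. rep_l2 f x)"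
proof -
  have "(LINT x|unit_lebesgue. rep_l2 (c *\<^sub>R f) x) = (LINT x|unit_lebesgue. c * rep_l2 f x)"
    by (rule integral_cong_AE) (auto intro: rep_l2_scaleR borel_measurable_times rep_l2_measurable)
  then show ?thesis by simp
qed

section \<open>Classical profiles\<close>

lemma integral_rep_abs_l2_mult:
  assumes F: "square_integrable F" and \<phi>: "continuous_on {0..1} \<phi>"
  shows "(LINT x|unit_lebesgue. rep_l2 (abs_l2 F) x * \<phi> x) = (LINT x|unit_lebesgue. F x * \<phi> x)"
proof (rule integral_cong_AE)
  show "AE x in unit_lebesgue. rep_l2 (abs_l2 F) x * \<phi> x = F x * \<phi> x"
    using rep_abs_l2[OF F] by eventually_elim simp
  show "(\<lambda>x. rep_l2 (abs_l2 F) x * \<phi> x) \<in> borel_measurable unit_lebesgue"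
    by (rule borel_measurable_integrable[OF integrable_test_mult[OF integrable_rep_l2 \<phi>]])
  show "(\<lambda>x. F x * \<phi> x) \<in> borel_measurable unit_lebesgue"
    by (rule borel_measurable_integrable[OF integrable_test_mult[OF square_integrable_integrable[OF F] \<phi>]])
qed

lemma has_weak_deriv_C1:
  assumes F: "\<And>x. (F has_real_derivative f x) (at x)" and f: "continuous_on UNIV f"
  shows "has_weak_deriv (abs_l2 F) (abs_l2 f)"
  unfolding has_weak_deriv_def
proof (intro allI impI)
  fix \<phi> \<phi>' assume \<phi>: "test_function \<phi> \<phi>'"
  have cont: "continuous_on A F" "continuous_on A f" for A
    using F by (blast intro: DERIV_continuous_on has_field_derivative_at_within)
      (rule continuous_on_subset[OF f], simp)
  have sq: "square_integrable F" "square_integrable f"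
    by (intro square_integrable_continuous cont)+
  have int: "integrable unit_lebesgue (\<lambda>x. F x * \<phi>' x)" "integrable unit_lebesgue (\<lambda>x. f x * \<phi> x)"
    by (intro integrable_test_mult square_integrable_integrable sq test_function_continuous[OF \<phi>])+
  obtain p q where "0 < p" "p < q" "q < 1" "\<And>x. x \<notin> {p..q} \<Longrightarrow> \<phi> x = 0"
    using test_functionE[OF \<phi>] by metis
  then have ends: "\<phi> 0 = 0" "\<phi> 1 = 0" by auto
  have "(LINT x|unit_lebesgue. F x * \<phi>' x + f x * \<phi> x) = F 1 * \<phi> 1 - F 0 * \<phi> 0"
  proof (rule integral_derivative_unit)
    show "((\<lambda>x. F x * \<phi> x) has_real_derivative F x * \<phi>' x + f x * \<phi> x) (at x)" for x
      using DERIV_mult'[OF F, of \<phi> "\<phi>' x" x] \<phi> by (simp add: test_function_def add.commute)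
    show "continuous_on UNIV (\<lambda>x. F x * \<phi>' x + f x * \<phi> x)"
      by (intro continuous_intros cont test_function_continuous[OF \<phi>])
  qed
  then have "(LINT x|unit_lebesgue. F x * \<phi>' x) = - (LINT x|unit_lebesgue. f x * \<phi> x)"
    using int ends by simp
  then show "(LINT x|unit_lebesgue. rep_l2 (abs_l2 F) x * \<phi>' x)
      = - (LINT x|unit_lebesgue. rep_l2 (abs_l2 f) x * \<phi> x)"
    by (simp add: integral_rep_abs_l2_mult sq test_function_continuous[OF \<phi>])
qed

lemma scaleR_abs_l2:
  assumes "square_integrable f"
  shows "c *\<^sub>R abs_l2 f = abs_l2 (\<lambda>x. c * f x)"
proof (rule l2_eqI)
  show "AE x in unit_lebesgue. rep_l2 (c *\<^sub>R abs_l2 f) x = rep_l2 (abs_l2 (\<lambda>x. c * f x)) x"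
    using rep_l2_scaleR[of c "abs_l2 f"] rep_abs_l2[OF assms]
      rep_abs_l2[OF square_integrable_scale[OF assms, of c]]
    by eventually_elim simp
qed

text \<open>
  The classes live on \<open>(0,1)\<close>, where the coefficient equals \<open>1\<close> and the product is \<open>f\<close> itself.
\<close>

lemma coeff_mult_one:
  assumes "\<forall>x\<in>{0..1}. a x = 1"
  shows "coeff_mult a f = f"
proof -
  have "square_integrable (\<lambda>x. a x * rep_l2 f x) \<longleftrightarrow> square_integrable (rep_l2 f)"
    unfolding square_integrable_def using assms
    by (intro arg_cong2[where f="(\<and>)"] measurable_cong Bochner_Integration.integrable_cong) auto
  then have "l2_rel (\<lambda>x. a x * rep_l2 f x) (rep_l2 f)"
    using assms by (auto simp: l2_rel_def)
  then show ?thesis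
    unfolding coeff_mult_def by (metis abs_l2_eqI abs_rep_l2)
qed

definition exp_profile :: "real \<Rightarrow> l2" where
  "exp_profile s = abs_l2 (\<lambda>x. exp (- s * x))"

lemma has_weak_deriv_exp_profile: "has_weak_deriv (exp_profile s) ((- s) *\<^sub>R exp_profile s)"
proof -
  have "square_integrable (\<lambda>x. exp (- s * x))"
    by (intro square_integrable_continuous continuous_intros)
  then have "(- s) *\<^sub>R exp_profile s = abs_l2 (\<lambda>x. (- s) * exp (- s * x))"
    unfolding exp_profile_def by (rule scaleR_abs_l2)
  moreover have "has_weak_deriv (exp_profile s) (abs_l2 (\<lambda>x. (- s) * exp (- s * x)))"
    unfolding exp_profile_def
    by (rule has_weak_deriv_C1) (auto intro!: derivative_eq_intros continuous_intros)
  ultimately show ?thesis by simp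
qed

lemma pt_value_exp_profile:
  assumes "x \<in> {0..1}"
  shows "pt_value (exp_profile s) x = exp (- s * x)"
  unfolding exp_profile_def
  by (rule pt_value_eqI[OF _ rep_abs_l2 assms])
    (intro continuous_intros square_integrable_continuous)+

lemma integral_exp_profile:
  assumes "s \<noteq> 0"
  shows "(LINT x|unit_lebesgue. rep_l2 (exp_profile s) x) = (1 - exp (- s)) / s"
proof -
  have "(LINT x|unit_lebesgue. rep_l2 (exp_profile s) x) = (LINT x|unit_lebesgue. exp (- s * x))"
    using integral_rep_abs_l2_mult[of "\<lambda>x. exp (- s * x)" "\<lambda>_. 1"]
    by (simp add: exp_profile_def square_integrable_continuous continuous_intros)
  also have "\<dots> = - exp (- s * 1) / s - - exp (- s * 0) / s"
    by (rule integral_derivative_unit)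
      (use assms in \<open>auto intro!: derivative_eq_intros continuous_intros\<close>)
  finally show ?thesis by (simp add: diff_divide_distrib)
qed

lemma exp_profile_nonzero: "exp_profile s \<noteq> 0"
proof
  assume "exp_profile s = 0"
  then have "pt_value (0::l2) 0 = 1" using pt_value_exp_profile[of 0 s] by simp
  moreover have "pt_value (0::l2) 0 = 0"
    using pt_value_scaleR[of 0 0 0] subspace_0[OF subspace_H1] by simp
  ultimately show False by simp
qed

section \<open>The state space\<close>

text \<open>
  Integrability of the representatives lets the first integral split, which exhibits \<open>J0\<close> as a combination
  of functionals of single components.
\<close>

lemma J0_eq:
  "J0 m M \<sigma> \<alpha> \<tau> (y, z, u, \<xi>, \<eta>) =
     \<sigma> * (LINT x|unit_lebesgue. rep_l2 y x) + (LINT x|unit_lebesgue. rep_l2 z x)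
     + m * \<xi> + M * \<eta> - \<alpha> * pt_value y 0 + \<tau> * \<alpha> * (LINT x|unit_lebesgue. rep_l2 u x)"
  by simp

lemma subspace_H0_space: "subspace H0_space"
  unfolding subspace_def H0_space_def
  using subspace_H1 by (auto simp: subspace_def zero_prod_def)

text \<open>
  The point value in \<open>J0\<close> is additive only because elements of \<open>H1\<close> have continuous representatives.
\<close>

lemma subspace_H0_tilde: "subspace (H0_tilde m M \<sigma> \<alpha> \<tau>)"
proof -
  have scale: "J0 m M \<sigma> \<alpha> \<tau> (c *\<^sub>R \<Phi>) = c * J0 m M \<sigma> \<alpha> \<tau> \<Phi>" if "\<Phi> \<in> H0_space" for c \<Phi>
    using that by (cases \<Phi>)
      (simp add: H0_space_def J0_eq integral_rep_l2_scaleR pt_value_scaleR algebra_simps del: J0.simps)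
  have add: "J0 m M \<sigma> \<alpha> \<tau> (\<Phi> + \<Psi>) = J0 m M \<sigma> \<alpha> \<tau> \<Phi> + J0 m M \<sigma> \<alpha> \<tau> \<Psi>"
    if "\<Phi> \<in> H0_space" "\<Psi> \<in> H0_space" for \<Phi> \<Psi>
    using that by (cases \<Phi>; cases \<Psi>)
      (simp add: H0_space_def J0_eq integral_rep_l2_add pt_value_add algebra_simps del: J0.simps)
  have "J0 m M \<sigma> \<alpha> \<tau> 0 = 0"
    using scale[of 0 0] subspace_0[OF subspace_H0_space] by simp
  then show ?thesis
    using subspace_H0_space by (auto simp: H0_tilde_def subspace_def add scale)
qed

lemma equilibrium_in_H0_space: "equilibrium C \<in> H0_space"
proof -
  have "has_weak_deriv (abs_l2 (\<lambda>_. C)) (abs_l2 (\<lambda>_. 0))"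
    by (rule has_weak_deriv_C1) auto
  then show ?thesis by (auto simp: equilibrium_def H0_space_def H1_def)
qed

text \<open>
  The norm of the product type omits the weak derivative of the first component.
\<close>

lemma norm_le_H0_product_norm: "norm \<Phi> \<le> H0_product_norm \<Phi>"
  by (cases \<Phi>) (simp add: norm_Pair)

section \<open>The growing mode\<close>

text \<open>
  The state \<open>(y, y\<^sub>t, u, y\<^sub>t(0), y\<^sub>t(1))\<close> at time \<open>0\<close> of the solution \<open>y(x,t) = exp (\<sigma> t - \<surd>2 \<sigma> x)\<close>.
  With the delay \<open>\<surd>2\<close>, the history \<open>u(x) = y\<^sub>t(0, - \<surd>2 x)\<close> coincides with the velocity profile.
\<close>

definition growing_mode :: "real \<Rightarrow> state" where
  "growing_mode \<sigma> =
     (let w = exp_profile (sqrt 2 * \<sigma>)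
      in (w, \<sigma> *\<^sub>R w, \<sigma> *\<^sub>R w, \<sigma>, \<sigma> * exp (- (sqrt 2 * \<sigma>))))"

lemma growing_mode_in_A0_domain: "growing_mode \<sigma> \<in> A0_domain"
proof -
  define w where "w = exp_profile (sqrt 2 * \<sigma>)"
  have deriv: "has_weak_deriv w ((- (sqrt 2 * \<sigma>)) *\<^sub>R w)"
    unfolding w_def by (rule has_weak_deriv_exp_profile)
  then have w: "w \<in> H1" by (auto simp: H1_def)
  have cw: "c *\<^sub>R w \<in> H1" for c using subspace_scale[OF subspace_H1 w] .
  have "w \<in> H2" using w cw[of "- (sqrt 2 * \<sigma>)"] by (simp add: H2_def weak_deriv_eqI[OF deriv])
  moreover have "pt_value (\<sigma> *\<^sub>R w) x = \<sigma> * exp (- (sqrt 2 * \<sigma>) * x)" if "x \<in> {0..1}" for x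
    using pt_value_scaleR[OF w that] pt_value_exp_profile[OF that] by (simp add: w_def)
  ultimately show ?thesis
    using cw by (simp add: growing_mode_def A0_domain_def Let_def flip: w_def)
qed

text \<open>
  The prescribed parameters settle one component each: \<open>\<tau> = \<surd>2\<close> the transport equation of the history, the value of
  \<open>\<alpha>\<close> the left end and the value of \<open>M\<close> the right end. The wave equation itself holds because the
  square of \<open>\<surd>2 \<sigma>\<close> is \<open>\<sigma>\<^sup>2 + \<sigma>\<^sup>2\<close>.
\<close>

lemma A0_growing_mode:
  assumes "m > 0" "\<sigma> > 0" and a: "\<forall>x\<in>{0..1}. a x = 1"
    and \<tau>: "\<tau> = sqrt 2" and M: "M = sqrt 2 / \<sigma>"
    and \<alpha>: "\<alpha> * exp (- (sqrt 2 * \<sigma>)) = sqrt 2 + m * \<sigma>"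
  shows "A0 a m M \<sigma> \<alpha> \<tau> (growing_mode \<sigma>) = \<sigma> *\<^sub>R growing_mode \<sigma>"
proof -
  define s where "s = sqrt 2 * \<sigma>"
  define w where "w = exp_profile s"
  have deriv: "has_weak_deriv (c *\<^sub>R w) ((- (c * s)) *\<^sub>R w)" for c
    using has_weak_deriv_scaleR[OF has_weak_deriv_exp_profile, of c s] by (simp add: w_def)
  have wd: "weak_deriv (c *\<^sub>R w) = (- (c * s)) *\<^sub>R w" for c
    by (rule weak_deriv_eqI[OF deriv])
  have w: "w \<in> H1" using deriv[of 1] by (auto simp: H1_def)
  have pt: "pt_value (c *\<^sub>R w) 0 = c" "pt_value (c *\<^sub>R w) 1 = c * exp (- s)" for c
    using pt_value_scaleR[OF w] pt_value_exp_profile by (simp_all add: w_def)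
  have s2: "s * s = 2 * (\<sigma> * \<sigma>)" by (simp add: s_def)
  have wd1: "weak_deriv w = (- s) *\<^sub>R w" using wd[of 1] by simp
  have 2: "weak_deriv ((- s) *\<^sub>R w) - \<sigma> *\<^sub>R \<sigma> *\<^sub>R w = \<sigma> *\<^sub>R \<sigma> *\<^sub>R w"
    by (simp only: wd minus_mult_left minus_minus s2 scaleR_scaleR flip: scaleR_left_diff_distrib) simp
  have 3: "- (weak_deriv (\<sigma> *\<^sub>R w) /\<^sub>R \<tau>) = \<sigma> *\<^sub>R \<sigma> *\<^sub>R w"
    by (simp add: wd \<tau> s_def)
  have 4: "(1 / m) * (pt_value ((- s) *\<^sub>R w) 0 + \<alpha> * pt_value (\<sigma> *\<^sub>R w) 1) = \<sigma> * \<sigma>"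
  proof -
    have "\<alpha> * (\<sigma> * exp (- s)) = \<sigma> * (\<alpha> * exp (- s))" by simp
    also have "\<dots> = \<sigma> * (sqrt 2 + m * \<sigma>)" using \<alpha> by (simp add: s_def)
    finally have "\<alpha> * (\<sigma> * exp (- s)) = \<sigma> * (sqrt 2 + m * \<sigma>)" .
    then show ?thesis using \<open>m > 0\<close> by (simp only: pt) (simp add: s_def field_simps)
  qed
  have 5: "- (pt_value ((- s) *\<^sub>R w) 1 / M) = \<sigma> * (\<sigma> * exp (- s))"
    using \<open>\<sigma> > 0\<close> by (simp only: pt M) (simp add: s_def field_simps)
  show ?thesis
    using 2 3 4 5
    by (simp add: growing_mode_def Let_def coeff_mult_one[OF a] wd1 flip: s_def w_def)
qed

lemma J0_growing_mode:
  assumes "\<sigma> > 0" and \<tau>: "\<tau> = sqrt 2" and M: "M = sqrt 2 / \<sigma>"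
    and \<alpha>: "\<alpha> * exp (- (sqrt 2 * \<sigma>)) = sqrt 2 + m * \<sigma>"
  shows "J0 m M \<sigma> \<alpha> \<tau> (growing_mode \<sigma>) = 0"
proof -
  define s where "s = sqrt 2 * \<sigma>"
  define w where "w = exp_profile s"
  have "\<sigma> * (LINT x|unit_lebesgue. rep_l2 w x) = \<sigma> * ((1 - exp (- s)) / s)"
    using assms(1) by (simp add: w_def s_def integral_exp_profile)
  also have "\<dots> = sqrt 2 / 2 * (1 - exp (- s))"
    using assms(1) by (simp add: s_def field_simps)
  finally have int: "\<sigma> * (LINT x|unit_lebesgue. rep_l2 w x) = sqrt 2 / 2 * (1 - exp (- s))" .
  have pt: "pt_value w 0 = 1" by (simp add: w_def pt_value_exp_profile)
  have mode: "growing_mode \<sigma> = (w, \<sigma> *\<^sub>R w, \<sigma> *\<^sub>R w, \<sigma>, \<sigma> * exp (- s))"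
    by (simp add: growing_mode_def Let_def w_def s_def)
  have sqrt2: "sqrt 2 * (sqrt 2 * r) = 2 * r" for r by (simp flip: mult.assoc)
  have "J0 m M \<sigma> \<alpha> \<tau> (growing_mode \<sigma>) =
      sqrt 2 * (1 - exp (- s)) + m * \<sigma> + sqrt 2 * exp (- s) - \<alpha> + \<alpha> * (1 - exp (- s))"
    unfolding mode J0_eq integral_rep_l2_scaleR int pt \<tau> M using assms(1) by (simp add: sqrt2 field_simps)
  also have "\<dots> = sqrt 2 + m * \<sigma> - \<alpha> * exp (- s)"
    by (simp add: algebra_simps)
  also have "\<dots> = 0" using \<alpha> by (simp add: s_def)
  finally show ?thesis .
qed

lemma not_tendsto_0_if_bounded_below:
  fixes f :: "real \<Rightarrow> real"
  assumes "d > 0" "\<And>t. t \<ge> 0 \<Longrightarrow> d \<le> f t"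
  shows "\<not> (f \<longlongrightarrow> 0) at_top"
proof
  assume "(f \<longlongrightarrow> 0) at_top"
  then have "\<forall>\<^sub>F t in at_top. f t < d" using assms(1) by (rule order_tendstoD)
  then have "\<forall>\<^sub>F t::real in at_top. False"
    using eventually_ge_at_top[of 0] by eventually_elim (use assms(2) in force)
  then show False by simp
qed

theorem theorem2:
  fixes a :: "real \<Rightarrow> real" and m \<sigma> \<tau> M \<alpha> K \<omega> :: real
    and T T' :: "real \<Rightarrow> state \<Rightarrow> state"
  defines "N \<equiv> H0_norm a m M \<sigma> \<alpha> \<tau> K \<omega>"
  assumes "m > 0" and "\<sigma> > 0"
    and "\<forall>x\<in>{0..1}. a x = 1"
    and "\<tau> = sqrt 2" and "M = sqrt 2 / \<sigma>"
    and "\<alpha> = sqrt 2 * (1 + m / M) * exp (2 / M)"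
    and "K > 0" and "\<alpha> \<le> K"
    and "\<omega> > 0" and "equivalent_norms_on H0_space N H0_product_norm"
    and "generates_c0_semigroup H0_space N A0_domain (A0 a m M \<sigma> \<alpha> \<tau>) T"
    and "generates_c0_semigroup (H0_tilde m M \<sigma> \<alpha> \<tau>) N (A0_tilde_domain m M \<sigma> \<alpha> \<tau>)
           (A0 a m M \<sigma> \<alpha> \<tau>) T'"
  shows "(\<exists>\<Phi>0 \<in> H0_tilde m M \<sigma> \<alpha> \<tau>. \<not> ((\<lambda>t. N (T' t \<Phi>0)) \<longlongrightarrow> 0) at_top) \<and>
         \<not> (\<forall>\<Phi>0 \<in> H0_space. \<exists>C. ((\<lambda>t. N (T t \<Phi>0 - equilibrium C)) \<longlongrightarrow> 0) at_top)"
proof -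
  have \<alpha>: "\<alpha> * exp (- (sqrt 2 * \<sigma>)) = sqrt 2 + m * \<sigma>"
  proof -
    have "2 / M = (2 / sqrt 2) * \<sigma>" by (simp add: assms(6))
    also have "\<dots> = sqrt 2 * \<sigma>" by (simp add: real_div_sqrt)
    finally have "2 / M = sqrt 2 * \<sigma>" .
    moreover have "sqrt 2 / M = \<sigma>" using assms(3,6) by simp
    then have "sqrt 2 * (1 + m / M) = sqrt 2 + m * \<sigma>" by (simp add: distrib_left flip: times_divide_eq_left)
    ultimately show ?thesis using assms(7) by (simp flip: exp_add)
  qed
  define \<Phi> where "\<Phi> = growing_mode \<sigma>"
  have dom: "\<Phi> \<in> A0_domain" unfolding \<Phi>_def by (rule growing_mode_in_A0_domain)
  then have \<Phi>_H0: "\<Phi> \<in> H0_space" by (auto simp: A0_domain_def H0_space_def H2_def)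
  then have \<Phi>_tilde: "\<Phi> \<in> H0_tilde m M \<sigma> \<alpha> \<tau>"
    using J0_growing_mode[OF assms(3,5,6) \<alpha>] by (simp add: H0_tilde_def \<Phi>_def)
  have eigen: "A0 a m M \<sigma> \<alpha> \<tau> \<Phi> = \<sigma> *\<^sub>R \<Phi>"
    unfolding \<Phi>_def by (rule A0_growing_mode[OF assms(2-6) \<alpha>])
  obtain c where "c > 0" and c: "\<And>\<Psi>. \<Psi> \<in> H0_space \<Longrightarrow> c * H0_product_norm \<Psi> \<le> N \<Psi>"
    using assms(11) by (auto simp: equivalent_norms_on_def)
  have bound: "norm \<Psi> \<le> (1 / c) * N \<Psi>" if "\<Psi> \<in> H0_space" for \<Psi>
  proof -
    have "c * norm \<Psi> \<le> N \<Psi>"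
      using c[OF that] mult_left_mono[OF norm_le_H0_product_norm[of \<Psi>], of c] \<open>c > 0\<close> by linarith
    then show ?thesis using \<open>c > 0\<close> by (simp add: field_simps)
  qed
  have tilde_sub: "\<Psi> \<in> H0_space" if "\<Psi> \<in> H0_tilde m M \<sigma> \<alpha> \<tau>" for \<Psi>
    using that by (simp add: H0_tilde_def)
  have T: "T t \<Phi> = exp (\<sigma> * t) *\<^sub>R \<Phi>" if "t \<ge> 0" for t
    using \<open>c > 0\<close>
    by (intro c0_semigroup_eigenvector[OF _ assms(12) subspace_H0_space bound dom eigen that]) auto
  have T': "T' t \<Phi> = exp (\<sigma> * t) *\<^sub>R \<Phi>" if "t \<ge> 0" for t
  proof (rule c0_semigroup_eigenvector[OF _ assms(13) subspace_H0_tilde bound[OF tilde_sub] _ eigen that])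
    show "\<Phi> \<in> A0_tilde_domain m M \<sigma> \<alpha> \<tau>"
      using dom \<Phi>_tilde by (simp add: A0_tilde_domain_def)
  qed (use \<open>c > 0\<close> in auto)
  have velocity: "norm (fst (snd \<Psi>)) \<le> norm \<Psi>" for \<Psi> :: state
    using norm_fst_le[of "fst (snd \<Psi>)" "snd (snd \<Psi>)"] norm_snd_le[of "snd \<Psi>" "fst \<Psi>"] by simp
  \<comment> \<open>Equilibria have zero velocity, so their distance to the orbit is at least \<open>c\<close> times the norm of the initial velocity.\<close>
  define d where "d = c * (\<sigma> * norm (exp_profile (sqrt 2 * \<sigma>)))"
  have "d > 0"
    using \<open>c > 0\<close> assms(3) exp_profile_nonzero by (simp add: d_def)
  have lower: "d \<le> N (exp (\<sigma> * t) *\<^sub>R \<Phi> - \<Psi>)"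
    if "t \<ge> 0" "\<Psi> \<in> H0_space" "fst (snd \<Psi>) = 0" for t \<Psi>
  proof -
    let ?v = "exp (\<sigma> * t) *\<^sub>R \<Phi> - \<Psi>"
    have v: "?v \<in> H0_space"
      by (intro subspace_diff subspace_scale subspace_H0_space \<Phi>_H0 that)
    have "fst (snd ?v) = (exp (\<sigma> * t) * \<sigma>) *\<^sub>R exp_profile (sqrt 2 * \<sigma>)"
      using that(3) by (simp add: \<Phi>_def growing_mode_def Let_def)
    then have "exp (\<sigma> * t) * \<sigma> * norm (exp_profile (sqrt 2 * \<sigma>)) = norm (fst (snd ?v))"
      using assms(3) by simp
    also have "\<dots> \<le> norm ?v" by (rule velocity)
    finally have "exp (\<sigma> * t) * d \<le> c * norm ?v"
      using \<open>c > 0\<close> by (simp add: d_def mult.assoc mult.left_commute)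
    moreover have "c * norm ?v \<le> N ?v"
      using bound[OF v] \<open>c > 0\<close> by (simp add: field_simps)
    moreover have "1 * d \<le> exp (\<sigma> * t) * d"
      using \<open>d > 0\<close> assms(3) that(1) by (intro mult_right_mono) auto
    ultimately show ?thesis by simp
  qed
  have "\<not> ((\<lambda>t. N (T' t \<Phi>)) \<longlongrightarrow> 0) at_top"
    using lower[of _ 0] subspace_0[OF subspace_H0_space]
    by (intro not_tendsto_0_if_bounded_below[OF \<open>d > 0\<close>]) (simp add: T')
  moreover have "\<not> ((\<lambda>t. N (T t \<Phi> - equilibrium C)) \<longlongrightarrow> 0) at_top" for C
    using lower[of _ "equilibrium C"] equilibrium_in_H0_space
    by (intro not_tendsto_0_if_bounded_below[OF \<open>d > 0\<close>]) (simp add: T equilibrium_def)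
  ultimately show ?thesis using \<Phi>_tilde \<Phi>_H0 by blast
qed

end
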